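(* Let $\gamma\in(0,1)$. There exist $c_1=c_1(\gamma)>0$ and $c_2=c_2(\gamma)>0$ such that when $\alpha\in(0,1]$ (for all $n$, $d$ and $p_0\in\mathcal{P}_d$) we have \[ \mathcal{E}_{n,\alpha}(p_0,\mathbb{L}_1)\ge c_1\max_{j=1,\dots,d}\min\biggl\{\frac{j^{1/2}}{(n\alpha^2)^{1/2}},\;\frac{p_0(j)}{\log^{1/2}(2j)}\biggr\} \] and \[ \mathcal{E}_{n,\alpha}(p_0,\mathbb{L}_2)\ge c_2\frac{1}{(n\alpha^2)^{1/2}}. \] In particular, let \[ \tilde\ell=\tilde\ell(n\alpha^2,p_0,\mathbb{L}_1):=\max\Bigl\{j=1,\dots,d:\frac{j^{1/2}}{(n\alpha^2)^{1/2}}\le\frac{p_0(j)}{\log^{1/2}(2j)}\Bigr\}. \] Then there exists $c_1=c_1(\gamma)>0$ such that when $\alpha\in(0,1]$ we have \[ \mathcal{E}_{n,\alpha}(p_0,\mathbb{L}_1)\ge c_1\frac{\tilde\ell^{1/2}}{(n\alpha^2)^{1/2}}. \]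
   Context: $[d]=\{1,\dots,d\}$ and $\mathcal{P}_d=\{p=(p(1),\dots,p(d))\in[0,1]^d:\sum_{j=1}^d p(j)=1\}$. Data $X_1,\dots,X_n$ are i.i.d. with $\mathbb{P}(X_i=j)=p(j)$ for an unknown $p\in\mathcal{P}_d$. For $r\in\{1,2\}$ let $\|\cdot\|_r$ be the $\ell_r$ norm on $\mathbb{R}^d$ and, for $\delta>0$, $H_1(\delta,\mathbb{L}_r)=\{p\in\mathcal{P}_d:\|p-p_0\|_r\ge\delta\}$; the null hypothesis is $p=p_0$ for a given $p_0\in\mathcal{P}_d$. An $\alpha$-LDP (locally differentially private, sequentially interactive) privacy mechanism $Q$ generates private data $Z_1,\dots,Z_n$ in a measurable space $\mathcal{Z}$ successively, where $Z_i$ is drawn from a conditional distribution $Q_i(\cdot\mid x_i,z_1,\dots,z_{i-1})$ given $X_i=x_i$ and $Z_1=z_1,\dots,Z_{i-1}=z_{i-1}$, with \[ Q_i(A\mid x,z_1,\dots,z_{i-1})\le e^{\alpha}\,Q_i(A\mid x',z_1,\dots,z_{i-1}) \] for all measurable $A$, all $z_1,\dots,z_{i-1}$, all $x,x'\in[d]$ and all $i=1,\dots,n$. The set of all such mechanisms is $\mathcal{Q}_\alpha$. $\Phi_Q$ is the set of (randomized) tests $\phi:\mathcal{Z}^n\to[0,1]$ based on $(Z_1,\dots,Z_n)$, and $\mathbb{E}_p$ denotes expectation when the $X_i$ are i.i.d. from $p$ and privatized by $Q$. Risks and radii: \[ \mathcal{R}_n(p_0,\delta,Q,\mathbb{L}_r)=\inf_{\phi\in\Phi_Q}\sup_{p\in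 H_1(\delta,\mathbb{L}_r)}\{\mathbb{E}_{p_0}(\phi)+\mathbb{E}_p(1-\phi)\}, \] $\mathcal{R}_{n,\alpha}(p_0,\delta,\mathbb{L}_r)=\inf_{Q\in\mathcal{Q}_\alpha}\mathcal{R}_n(p_0,\delta,Q,\mathbb{L}_r)$, and, for the fixed level $\gamma\in(0,1)$, $\mathcal{E}_{n,\alpha}(p_0,\mathbb{L}_r)=\inf\{\delta>0:\mathcal{R}_{n,\alpha}(p_0,\delta,\mathbb{L}_r)\le\gamma\}$.
   Formalization: For the L_1 bounds p_0 is assumed ordered, p_0(1)≥…≥p_0(d) (false otherwise: point mass at d, n=d, α=1); the radius uses only δ with H_1(δ) nonempty (else false for d=1 or small nα²); an empty max is 0; constants are stated per underlying set of Z, uniformity follows by disjoint unions. *)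

theory Defs
  imports "HOL-Probability.Probability"
begin

text \<open>Vectors indexed by \<open>{1..d}\<close> are extensional functions on \<open>nat\<close>: the dimension has to be a
  term, since the constants in the lower bounds must not depend on it.\<close>

definition prob_simplex :: "nat \<Rightarrow> (nat \<Rightarrow> real) set" where
  "prob_simplex d = {p \<in> {1..d} \<rightarrow>\<^sub>E {0..1}. (\<Sum>j=1..d. p j) = 1}"

definition data_law :: "nat \<Rightarrow> (nat \<Rightarrow> real) \<Rightarrow> nat measure" where
  "data_law d p = point_measure {1..d} (\<lambda>j. ennreal (p j))"

definition lr_dist :: "nat \<Rightarrow> nat \<Rightarrow> (nat \<Rightarrow> real) \<Rightarrow> (nat \<Rightarrow> real) \<Rightarrow> real" where
  "lr_dist r d p q = root r (\<Sum>j=1..d. \<bar>p j - q j\<bar> ^ r)"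

definition H1 :: "nat \<Rightarrow> (nat \<Rightarrow> real) \<Rightarrow> real \<Rightarrow> nat \<Rightarrow> (nat \<Rightarrow> real) set" where
  "H1 d p0 \<delta> r = {p \<in> prob_simplex d. \<delta> \<le> lr_dist r d p p0}"

text \<open>A mechanism consists of the measurable space \<open>Z\<close> of private data and the kernels \<open>Q\<close>, where
  \<open>Q i x z\<close> is the conditional law of \<open>Z\<^sub>i\<close> given \<open>X\<^sub>i = x\<close> and the history
  \<open>z = (Z\<^sub>1, \<dots>, Z\<^sub>i\<^sub>-\<^sub>1)\<close>, a point of the product of \<open>i - 1\<close> copies of \<open>Z\<close>. Only the measurable space
  underlying \<open>Z\<close> matters, not the measure it carries.\<close>

type_synonym 'z mechanism = "'z measure \<times> (nat \<Rightarrow> nat \<Rightarrow> (nat \<Rightarrow> 'z) \<Rightarrow> 'z measure)"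

definition ldp_mechanisms :: "real \<Rightarrow> nat \<Rightarrow> nat \<Rightarrow> 'z mechanism set" where
  "ldp_mechanisms \<alpha> n d = {(Z, Q).
     (\<forall>i\<in>{1..n}. \<forall>x\<in>{1..d}. Q i x \<in> (\<Pi>\<^sub>M k\<in>{1..<i}. Z) \<rightarrow>\<^sub>M prob_algebra Z) \<and>
     (\<forall>i\<in>{1..n}. \<forall>z\<in>space (\<Pi>\<^sub>M k\<in>{1..<i}. Z). \<forall>x\<in>{1..d}. \<forall>x'\<in>{1..d}. \<forall>A\<in>sets Z.
        measure (Q i x z) A \<le> exp \<alpha> * measure (Q i x' z) A)}"

text \<open>The joint law of \<open>(Z\<^sub>1, \<dots>, Z\<^sub>i)\<close>: each step draws a fresh \<open>x\<close> from \<open>p\<close>, independently of the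
  past, and then the next private observation \<open>y\<close> given \<open>x\<close> and the history \<open>z\<close>.\<close>

primrec private_law :: "'z mechanism \<Rightarrow> nat \<Rightarrow> (nat \<Rightarrow> real) \<Rightarrow> nat \<Rightarrow> (nat \<Rightarrow> 'z) measure" where
  "private_law M d p 0 = return (\<Pi>\<^sub>M k\<in>{1..0}. fst M) (\<lambda>_. undefined)"
| "private_law M d p (Suc i) =
     private_law M d p i \<bind> (\<lambda>z. data_law d p \<bind> (\<lambda>x. snd M (Suc i) x z \<bind>
       (\<lambda>y. return (\<Pi>\<^sub>M k\<in>{1..Suc i}. fst M) (z(Suc i := y)))))"

definition tests :: "'z mechanism \<Rightarrow> nat \<Rightarrow> ((nat \<Rightarrow> 'z) \<Rightarrow> real) set" where
  "tests M n = {\<phi> \<in> borel_measurable (\<Pi>\<^sub>M k\<in>{1..n}. fst M).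
     \<forall>z\<in>space (\<Pi>\<^sub>M k\<in>{1..n}. fst M). \<phi> z \<in> {0..1}}"

definition expect :: "'z mechanism \<Rightarrow> nat \<Rightarrow> nat \<Rightarrow> (nat \<Rightarrow> real) \<Rightarrow> ((nat \<Rightarrow> 'z) \<Rightarrow> real) \<Rightarrow> real" where
  "expect M n d p \<phi> = (\<integral>z. \<phi> z \<partial>private_law M d p n)"

definition risk :: "nat \<Rightarrow> nat \<Rightarrow> (nat \<Rightarrow> real) \<Rightarrow> real \<Rightarrow> 'z mechanism \<Rightarrow> nat \<Rightarrow> ereal" where
  "risk n d p0 \<delta> M r = (INF \<phi>\<in>tests M n. SUP p\<in>H1 d p0 \<delta> r.
     ereal (expect M n d p0 \<phi> + expect M n d p (\<lambda>z. 1 - \<phi> z)))"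

definition ldp_risk ::
  "'z itself \<Rightarrow> nat \<Rightarrow> real \<Rightarrow> nat \<Rightarrow> (nat \<Rightarrow> real) \<Rightarrow> real \<Rightarrow> nat \<Rightarrow> ereal" where
  "ldp_risk _ n \<alpha> d p0 \<delta> r = (INF M\<in>(ldp_mechanisms \<alpha> n d :: 'z mechanism set). risk n d p0 \<delta> M r)"

text \<open>The radius ranges over those \<open>\<delta>\<close> for which there is an alternative to test against. With
  \<open>Sup {} = -\<infinity>\<close> an empty alternative would count as perfectly testable, the radius would never
  exceed the diameter of the simplex, and no lower bound of order \<open>1 / sqrt (n * \<alpha>\<^sup>2)\<close> could hold for
  small \<open>n * \<alpha>\<^sup>2\<close>. The radius is \<open>\<infinity>\<close> if no such \<open>\<delta>\<close> reaches risk \<open>\<gamma>\<close>.\<close>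

definition critical_radius ::
  "'z itself \<Rightarrow> real \<Rightarrow> nat \<Rightarrow> real \<Rightarrow> nat \<Rightarrow> (nat \<Rightarrow> real) \<Rightarrow> nat \<Rightarrow> ereal" where
  "critical_radius Z \<gamma> n \<alpha> d p0 r =
     Inf {ereal \<delta> | \<delta>. 0 < \<delta> \<and> H1 d p0 \<delta> r \<noteq> {} \<and> ldp_risk Z n \<alpha> d p0 \<delta> r \<le> ereal \<gamma>}"

text \<open>The maximum of the empty set is read as 0.\<close>

definition ell_tilde :: "real \<Rightarrow> nat \<Rightarrow> (nat \<Rightarrow> real) \<Rightarrow> nat" where
  "ell_tilde N d p0 =
     Max (insert 0 {j \<in> {1..d}. sqrt (real j) / sqrt N \<le> p0 j / sqrt (ln (2 * real j))})"

end

theory Submission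
  imports Defs
begin

text \<open>For finitely many alternatives \<open>\<pi> \<xi>\<close> and functions \<open>h \<xi> \<ge> 1\<close> of the private data, the total gap
  between \<open>E\<^sub>p\<^sub>0 (ln (h \<xi>))\<close> and \<open>ln (E\<^sub>\<pi>\<^sub>\<xi> (h \<xi>))\<close> is bounded, in the spirit of the Donsker-Varadhan formula,
  one observation at a time. Given the history, the law of the next private observation under \<open>\<pi> \<xi>\<close> has
  density \<open>1 + u\<close> with respect to its law under \<open>p\<^sub>0\<close>, where \<open>u\<close> is linear in \<open>\<pi> \<xi> - p\<^sub>0\<close> with coefficients of
  order \<open>\<alpha>\<close> by privacy. Jensen's inequality then bounds the gap by the mean of \<open>3 * u\<^sup>2\<close>. Only the average
  over \<open>\<xi>\<close> of \<open>u\<^sup>2\<close> is controlled, uniformly in the mechanism, so the increments are summed over \<open>\<xi>\<close> before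
  the history is integrated out, always under \<open>p\<^sub>0\<close>. With \<open>h = 1 + t * (1 - \<phi>)\<close> this yields a lower bound on the average
  risk of a test \<open>\<phi>\<close>.

  For the \<open>L\<^sub>1\<close> norm and \<open>j \<ge> 2\<close> the alternatives move mass, with arbitrary signs, inside \<open>j div 2\<close> pairs of
  neighbouring cells. For \<open>j = 1\<close> and for the \<open>L\<^sub>2\<close> norm a single alternative on a segment starting
  at \<open>p\<^sub>0\<close> suffices.\<close>

subsection \<open>Bounded densities\<close>

text \<open>Jensen's inequality, obtained from the tangent of \<open>ln\<close> at the mean
  \<open>m\<close>: \<open>ln (f x) \<le> ln m + (f x / m - 1)\<close>, whose last term integrates
  to zero. The two bounds make both \<open>f\<close> and \<open>ln f\<close> integrable.\<close>

lemma (in prob_space) expectation_ln_le: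
  fixes f :: "'a \<Rightarrow> real"
  assumes f[measurable]: "f \<in> borel_measurable M" and "0 < a"
    and bnd: "\<And>x. x \<in> space M \<Longrightarrow> a \<le> f x \<and> f x \<le> b"
  shows "expectation (\<lambda>x. ln (f x)) \<le> ln (expectation f)"
proof -
  have pos: "f x > 0" if "x \<in> space M" for x
    using bnd[OF that] \<open>0 < a\<close> by linarith
  have int: "integrable M f"
    using bnd \<open>0 < a\<close> by (intro integrable_const_bound[of _ b] AE_I2 f) fastforce
  have "\<bar>ln (f x)\<bar> \<le> \<bar>ln a\<bar> + \<bar>ln b\<bar>" if "x \<in> space M" for x
  proof -
    have "ln a \<le> ln (f x)" "ln (f x) \<le> ln b"
      using bnd[OF that] \<open>0 < a\<close> by auto
    then show ?thesis by linarith
  qed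
  then have int_ln: "integrable M (\<lambda>x. ln (f x))"
    by (intro integrable_const_bound[of _ "\<bar>ln a\<bar> + \<bar>ln b\<bar>"] AE_I2) auto
  define m where "m = expectation f"
  have "a \<le> m"
    using integral_ge_const[OF int] bnd unfolding m_def by auto
  then have m: "m > 0" using \<open>0 < a\<close> by linarith
  have "expectation (\<lambda>x. ln (f x)) \<le> expectation (\<lambda>x. ln m + (f x / m - 1))"
  proof (intro integral_mono int_ln)
    show "ln (f x) \<le> ln m + (f x / m - 1)" if "x \<in> space M" for x
      using ln_le_minus_one[of "f x / m"] pos[OF that] m by (simp add: ln_div)
  qed (use int in auto)
  also have "\<dots> = ln m + (m / m - 1)"
    using int by (simp add: prob_space m_def)
  finally show ?thesis using m by (simp add: m_def)
qed

text \<open>The inequality is tested on the set where \<open>g < f\<close>. There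
  \<open>w = f - g\<close> is positive, yet its integral is at most 0, so the set is null.\<close>

lemma AE_le_of_set_integral_le:
  fixes f g :: "'a \<Rightarrow> real"
  assumes f: "integrable M f" and g: "integrable M g"
    and le: "\<And>A. A \<in> sets M \<Longrightarrow> (\<integral>x. f x * indicat_real A x \<partial>M) \<le> (\<integral>x. g x * indicat_real A x \<partial>M)"
  shows "AE x in M. f x \<le> g x"
proof -
  note [measurable] = borel_measurable_integrable[OF f] borel_measurable_integrable[OF g]
  define A where "A = {x \<in> space M. g x < f x}"
  have A[measurable]: "A \<in> sets M" unfolding A_def by measurable
  define w where "w = (\<lambda>x. f x * indicat_real A x - g x * indicat_real A x)"
  have i: "integrable M (\<lambda>x. f x * indicat_real A x)" "integrable M (\<lambda>x. g x * indicat_real A x)"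
    using integrable_real_mult_indicator[OF A] f g by auto
  then have w: "integrable M w" unfolding w_def by auto
  have nn: "AE x in M. 0 \<le> w x"
    by (auto simp: A_def w_def indicator_def)
  have "integral\<^sup>L M w \<le> 0"
    unfolding w_def using i le[OF A] by simp
  then have "integral\<^sup>L M w = 0"
    using integral_nonneg_AE[OF nn] by linarith
  then have "AE x in M. w x = 0"
    using integral_nonneg_eq_0_iff_AE[OF w nn] by simp
  with AE_space show ?thesis
    by eventually_elim (auto simp: A_def w_def indicator_def split: if_splits)
qed

text \<open>\<open>upper\<close> gives absolute continuity, hence a Radon-Nikodym derivative, and
  the two comparisons bound it almost everywhere. Truncation turns these into bounds at every point,
  so that finite combinations of densities can later be estimated pointwise.\<close>

lemma (in prob_space) bounded_density_exists:
  assumes N: "prob_space N" and sets: "sets N = sets M" and "0 < b"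
    and upper: "\<And>A. A \<in> sets M \<Longrightarrow> measure N A \<le> b * prob A"
    and lower: "\<And>A. A \<in> sets M \<Longrightarrow> prob A \<le> b * measure N A"
  shows "\<exists>f\<in>borel_measurable M. (\<forall>x. 1 / b \<le> f x \<and> f x \<le> b) \<and>
           (\<forall>g\<in>borel_measurable M. integral\<^sup>L N g = (\<integral>x. f x * g x \<partial>M))"
proof -
  interpret N: prob_space N by fact
  note [simp] = sets_eq_imp_space_eq[OF sets]
  have ac: "absolutely_continuous M N"
  proof (unfold absolutely_continuous_def, intro subsetI)
    fix A assume A: "A \<in> null_sets M"
    then have "prob A = 0" by (simp add: null_sets_def emeasure_eq_measure)
    then have "measure N A \<le> 0" using upper[of A] A by (simp add: null_sets_def)
    then have "measure N A = 0" using measure_nonneg[of N A] by linarith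
    then show "A \<in> null_sets N"
      using A by (simp add: null_sets_def sets N.emeasure_eq_measure)
  qed
  define f0 where "f0 = (\<lambda>x. enn2real (RN_deriv M N x))"
  have f0[measurable]: "f0 \<in> borel_measurable M" unfolding f0_def by measurable
  have sf: "sigma_finite_measure N" by unfold_locales
  have f0_int: "integral\<^sup>L N g = (\<integral>x. f0 x * g x \<partial>M)" if "g \<in> borel_measurable M" for g :: "_ \<Rightarrow> real"
    unfolding f0_def by (rule RN_deriv_integral[OF sf ac sets that])
  have int_f0: "integrable M f0"
    using RN_deriv_integrable[OF sf ac sets, of "\<lambda>_. 1"] unfolding f0_def by simp
  have meas: "measure N A = (\<integral>x. f0 x * indicat_real A x \<partial>M)" if "A \<in> sets M" for A
    using f0_int[of "indicat_real A"] that by (simp add: sets sets.Int_space_eq2)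
  have "AE x in M. f0 x \<le> b"
  proof (rule AE_le_of_set_integral_le)
    show "(\<integral>x. f0 x * indicat_real A x \<partial>M) \<le> (\<integral>x. b * indicat_real A x \<partial>M)" if "A \<in> sets M" for A
      using upper[OF that] that by (simp add: meas[symmetric])
  qed (use int_f0 in auto)
  moreover have "AE x in M. 1 / b \<le> f0 x"
  proof (rule AE_le_of_set_integral_le)
    show "(\<integral>x. 1 / b * indicat_real A x \<partial>M) \<le> (\<integral>x. f0 x * indicat_real A x \<partial>M)" if "A \<in> sets M" for A
      using lower[OF that] that \<open>0 < b\<close> by (simp add: meas[symmetric] field_simps)
  qed (use int_f0 in auto)
  ultimately have bounds: "AE x in M. 1 / b \<le> f0 x \<and> f0 x \<le> b" by auto
  define f where "f = (\<lambda>x. max (1 / b) (min b (f0 x)))"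
  have f[measurable]: "f \<in> borel_measurable M" unfolding f_def by measurable
  \<comment> \<open>Taking the whole space in \<open>upper\<close> shows \<open>1 \<le> b\<close>,
    so the truncation interval from \<open>1 / b\<close> to \<open>b\<close> is nonempty.\<close>
  have "1 \<le> b"
    using upper[of "space M"] by (simp add: prob_space N.prob_space[simplified])
  then have "1 / b \<le> b" by (simp add: divide_le_eq) (metis mult_mono' mult_1 zero_le_one)
  then have "1 / b \<le> f x \<and> f x \<le> b" for x by (auto simp: f_def)
  moreover have "integral\<^sup>L N g = (\<integral>x. f x * g x \<partial>M)" if g[measurable]: "g \<in> borel_measurable M" for g :: "_ \<Rightarrow> real"
  proof -
    have "(\<integral>x. f0 x * g x \<partial>M) = (\<integral>x. f x * g x \<partial>M)"
      by (rule integral_cong_AE) (use bounds in \<open>auto simp: f_def elim: eventually_mono\<close>)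
    then show ?thesis using f0_int[OF g] by simp
  qed
  ultimately show ?thesis using f by blast
qed

subsection \<open>A single private observation\<close>

lemma prob_simplexD:
  assumes "p \<in> prob_simplex d"
  shows "(\<Sum>x=1..d. p x) = 1" "\<And>x. x \<in> {1..d} \<Longrightarrow> 0 \<le> p x" "1 \<le> d"
proof -
  show s: "(\<Sum>x=1..d. p x) = 1" using assms by (simp add: prob_simplex_def)
  show "0 \<le> p x" if "x \<in> {1..d}" for x
    using assms that by (fastforce simp: prob_simplex_def PiE_def Pi_def)
  show "1 \<le> d" using s by (cases d) auto
qed

lemma sets_data_law [measurable_cong]: "sets (data_law d p) = sets (count_space {1..d})"
  by (simp add: data_law_def sets_point_measure_count_space)

lemma space_data_law: "space (data_law d p) = {1..d}"
  by (simp add: data_law_def space_point_measure)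

lemma prob_space_data_law:
  assumes "p \<in> prob_simplex d"
  shows "prob_space (data_law d p)"
proof
  have "emeasure (data_law d p) {1..d} = (\<Sum>x=1..d. ennreal (p x))"
    unfolding data_law_def by (rule emeasure_point_measure_finite2) auto
  also have "\<dots> = ennreal (\<Sum>x=1..d. p x)"
    by (rule sum_ennreal) (use prob_simplexD[OF assms] in auto)
  finally show "emeasure (data_law d p) (space (data_law d p)) = 1"
    using prob_simplexD(1)[OF assms] by (simp add: space_data_law)
qed

lemma measurable_data_law:
  "(\<And>x. x \<in> {1..d} \<Longrightarrow> K x \<in> space N) \<Longrightarrow> K \<in> data_law d p \<rightarrow>\<^sub>M N"
  by (simp add: measurable_cong_sets[OF sets_data_law refl])

lemma integral_bind_data_law:
  fixes g :: "'z \<Rightarrow> real"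
  assumes p: "p \<in> prob_simplex d" and K: "\<And>x. x \<in> {1..d} \<Longrightarrow> K x \<in> space (prob_algebra Z)"
    and g[measurable]: "g \<in> borel_measurable Z" and bnd: "\<And>y. y \<in> space Z \<Longrightarrow> \<bar>g y\<bar> \<le> C"
  shows "(\<integral>y. g y \<partial>(data_law d p \<bind> K)) = (\<Sum>x=1..d. p x * (\<integral>y. g y \<partial>K x))"
proof -
  interpret prob_space "data_law d p" by (rule prob_space_data_law[OF p])
  have "(\<integral>y. g y \<partial>(data_law d p \<bind> K)) = (\<integral>x. (\<integral>y. g y \<partial>K x) \<partial>data_law d p)"
  proof (rule integral_bind[where K=Z and B'=1])
    show "K \<in> data_law d p \<rightarrow>\<^sub>M subprob_algebra Z"
      using K by (intro measurable_data_law) (auto simp: space_prob_algebra space_subprob_algebra prob_space_imp_subprob_space)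
    show "AE x in data_law d p. emeasure (K x) (space (K x)) \<le> ennreal 1"
      using K by (intro AE_I2) (auto simp: space_data_law space_prob_algebra intro: prob_space.emeasure_le_1)
  qed (use bnd in \<open>auto intro: finite_measure_axioms\<close>)
  also have "\<dots> = (\<Sum>x=1..d. p x * (\<integral>y. g y \<partial>K x))"
    unfolding data_law_def
    by (subst lebesgue_integral_point_measure_finite) (use prob_simplexD[OF p] in auto)
  finally show ?thesis .
qed

lemma bind_data_law_in_prob_algebra:
  assumes p: "p \<in> prob_simplex d" and K: "\<And>x. x \<in> {1..d} \<Longrightarrow> K x \<in> space (prob_algebra Z)"
  shows "data_law d p \<bind> K \<in> space (prob_algebra Z)"
proof -
  have K': "K \<in> data_law d p \<rightarrow>\<^sub>M subprob_algebra Z"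
    using K by (intro measurable_data_law) (auto simp: space_prob_algebra space_subprob_algebra prob_space_imp_subprob_space)
  have "prob_space (data_law d p \<bind> K)"
    by (rule prob_space.prob_space_bind[OF prob_space_data_law[OF p] _ K'])
       (use K in \<open>auto intro!: AE_I2 simp: space_data_law space_prob_algebra\<close>)
  moreover have "sets (data_law d p \<bind> K) = sets Z"
    by (rule sets_bind) (use K prob_simplexD(3)[OF p] in \<open>auto simp: space_data_law space_prob_algebra\<close>)
  ultimately show ?thesis by (simp add: space_prob_algebra)
qed

text \<open>The bound \<open>ln t \<le> t - 1\<close> is used at \<open>t = 1 / (1 + u)\<close>; the
  factor \<open>1 / (1 + u)\<close> of the quadratic term is at most \<open>exp 1 \<le> 3\<close>.
  Densities bounded below by \<open>1 / exp \<alpha>\<close> with \<open>\<alpha> \<le> 1\<close>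
  meet the threshold \<open>exp (- 1)\<close>.\<close>

lemma ln_one_plus_ge_quadratic:
  fixes u :: real
  assumes "exp (- 1) \<le> 1 + u"
  shows "u - 3 * u\<^sup>2 \<le> ln (1 + u)"
proof -
  have pos: "0 < 1 + u" using assms by (smt (verit) exp_gt_zero)
  have "- ln (1 + u) = ln (1 / (1 + u))" using pos by (simp add: ln_div)
  also have "\<dots> \<le> 1 / (1 + u) - 1" using pos by (intro ln_le_minus_one) simp
  also have "\<dots> = - u + u\<^sup>2 * (1 / (1 + u))"
    using pos by (simp add: field_simps power2_eq_square)
  also have "\<dots> \<le> - u + u\<^sup>2 * 3"
  proof -
    have "1 / (1 + u) \<le> 1 / exp (- 1)"
      using assms pos by (intro divide_left_mono) auto
    also have "\<dots> = exp (1::real)" by (simp add: exp_minus field_simps)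
    also have "\<dots> \<le> 3" by (rule exp_le)
    finally show ?thesis by (intro add_left_mono mult_left_mono) auto
  qed
  finally show ?thesis by simp
qed

text \<open>Privacy bounds likelihood ratios by \<open>exp \<alpha>\<close>; this turns such a bound
  into a deviation from 1 that is linear in \<open>\<alpha>\<close>, hence the factor
  \<open>\<alpha>\<^sup>2\<close> after squaring.\<close>

lemma abs_diff_one_le_two_mult:
  fixes a t :: real
  assumes a: "0 < a" "a \<le> 1" and t: "1 / exp a \<le> t" "t \<le> exp a"
  shows "\<bar>t - 1\<bar> \<le> 2 * a"
proof -
  have "exp a \<le> 1 + a + a\<^sup>2" using exp_bound[of a] a by simp
  also have "a\<^sup>2 \<le> a" using a by (simp add: power2_eq_square mult_left_le)
  finally have "t \<le> 1 + 2 * a" using t by simp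
  moreover have "1 - a \<le> t"
    using exp_ge_add_one_self[of "- a"] t by (simp add: exp_minus inverse_eq_divide)
  ultimately show ?thesis using a by (auto simp: abs_le_iff)
qed

text \<open>The history is frozen and \<open>q\<close> are the kernels at it. \<open>S\<close>
  measures how visible the alternatives are on average to a function with values in [-1, 1]. The
  constant 12 is the 3 of the quadratic bound for \<open>ln\<close> times the square of the 2 in the
  linear bound for densities.\<close>

lemma one_step_information_bound:
  fixes q :: "nat \<Rightarrow> 'z measure" and \<pi> :: "'x \<Rightarrow> nat \<Rightarrow> real" and h :: "'x \<Rightarrow> 'z \<Rightarrow> real"
    and S :: real
  assumes q: "\<And>x. x \<in> {1..d} \<Longrightarrow> q x \<in> space (prob_algebra Z)"
    and ldp: "\<And>x x' A. x \<in> {1..d} \<Longrightarrow> x' \<in> {1..d} \<Longrightarrow> A \<in> sets Z \<Longrightarrow>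
                measure (q x) A \<le> exp \<alpha> * measure (q x') A"
    and \<alpha>: "0 < \<alpha>" "\<alpha> \<le> 1"
    and p0: "p0 \<in> prob_simplex d" and \<pi>: "\<And>\<xi>. \<xi> \<in> \<Xi> \<Longrightarrow> \<pi> \<xi> \<in> prob_simplex d"
    and S: "\<And>g. (\<And>x. \<bar>g x\<bar> \<le> 1) \<Longrightarrow>
              (\<Sum>\<xi>\<in>\<Xi>. (\<Sum>x=1..d. (\<pi> \<xi> x - p0 x) * g x)\<^sup>2) \<le> S * card \<Xi>"
    and h: "\<And>\<xi>. \<xi> \<in> \<Xi> \<Longrightarrow> h \<xi> \<in> borel_measurable Z"
    and bnd: "\<And>\<xi> y. \<xi> \<in> \<Xi> \<Longrightarrow> y \<in> space Z \<Longrightarrow> 1 \<le> h \<xi> y \<and> h \<xi> y \<le> b"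
  shows "(\<Sum>\<xi>\<in>\<Xi>. \<Sum>x=1..d. p0 x * (\<integral>y. ln (h \<xi> y) \<partial>q x))
           \<le> 12 * \<alpha>\<^sup>2 * S * card \<Xi> + (\<Sum>\<xi>\<in>\<Xi>. ln (\<Sum>x=1..d. \<pi> \<xi> x * (\<integral>y. h \<xi> y \<partial>q x)))"
proof -
  \<comment> \<open>The law of the observation under \<open>p0\<close> serves as dominating measure:
    as a mixture of the \<open>q x'\<close>, it is within a factor \<open>exp \<alpha>\<close> of
    every \<open>q x\<close>.\<close>
  define P where "P = data_law d p0 \<bind> q"
  note p0D = prob_simplexD[OF p0]
  have P: "prob_space P" and setsP[measurable_cong]: "sets P = sets Z"
    using bind_data_law_in_prob_algebra[OF p0 q] by (auto simp: P_def space_prob_algebra)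
  have spaceP: "space P = space Z" by (rule sets_eq_imp_space_eq[OF setsP])
  interpret P: prob_space P by fact
  have intP: "(\<integral>y. g y \<partial>P) = (\<Sum>x=1..d. p0 x * (\<integral>y. g y \<partial>q x))"
    if "g \<in> borel_measurable Z" "\<And>y. y \<in> space Z \<Longrightarrow> \<bar>g y\<bar> \<le> C" for g :: "'z \<Rightarrow> real" and C
    unfolding P_def using that by (intro integral_bind_data_law[OF p0 q]) auto
  have integrableP: "integrable P g"
    if "g \<in> borel_measurable Z" "\<And>y. y \<in> space Z \<Longrightarrow> \<bar>g y\<bar> \<le> C" for g :: "'z \<Rightarrow> real" and C
    using that by (intro P.integrable_const_bound[of _ C] AE_I2) (auto simp: spaceP measurable_cong_sets[OF setsP refl])
  have qD: "prob_space (q x)" "sets (q x) = sets Z" "space (q x) = space Z" if "x \<in> {1..d}" for x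
    using q[OF that] sets_eq_imp_space_eq[of "q x" Z] by (simp_all add: space_prob_algebra)
  have measP: "measure P A = (\<Sum>x=1..d. p0 x * measure (q x) A)" if "A \<in> sets Z" for A
  proof -
    have "(\<integral>y. indicat_real A y \<partial>P) = (\<Sum>x=1..d. p0 x * (\<integral>y. indicat_real A y \<partial>q x))"
      using that by (intro intP[of _ 1]) auto
    then show ?thesis
      using sets.sets_into_space[OF that] by (simp add: spaceP qD Int_absorb2 cong: sum.cong_simp)
  qed
  have "\<exists>f\<in>borel_measurable P. (\<forall>y. 1 / exp \<alpha> \<le> f y \<and> f y \<le> exp \<alpha>) \<and>
           (\<forall>g\<in>borel_measurable P. integral\<^sup>L (q x) g = (\<integral>y. f y * g y \<partial>P))" if x: "x \<in> {1..d}" for x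
  proof (rule P.bounded_density_exists)
    fix A assume "A \<in> sets P"
    then have A: "A \<in> sets Z" by (simp add: setsP)
    have "measure (q x) A = (\<Sum>x'=1..d. p0 x' * measure (q x) A)"
      using p0D(1) by (simp add: sum_distrib_right[symmetric])
    also have "\<dots> \<le> (\<Sum>x'=1..d. p0 x' * (exp \<alpha> * measure (q x') A))"
      using p0D(2) ldp[OF x _ A] by (intro sum_mono mult_left_mono) auto
    also have "\<dots> = exp \<alpha> * measure P A" by (simp add: measP[OF A] sum_distrib_left mult_ac)
    finally show "measure (q x) A \<le> exp \<alpha> * measure P A" .
    have "measure P A \<le> (\<Sum>x'=1..d. p0 x' * (exp \<alpha> * measure (q x) A))"
      unfolding measP[OF A] using p0D(2) ldp[OF _ x A] by (intro sum_mono mult_left_mono) auto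
    also have "\<dots> = exp \<alpha> * measure (q x) A"
      using p0D(1) by (simp add: sum_distrib_right[symmetric])
    finally show "measure P A \<le> exp \<alpha> * measure (q x) A" .
  qed (use qD[OF x] setsP in auto)
  then obtain f where f: "\<And>x. x \<in> {1..d} \<Longrightarrow> f x \<in> borel_measurable P"
    "\<And>x y. x \<in> {1..d} \<Longrightarrow> 1 / exp \<alpha> \<le> f x y" "\<And>x y. x \<in> {1..d} \<Longrightarrow> f x y \<le> exp \<alpha>"
    "\<And>x g. x \<in> {1..d} \<Longrightarrow> g \<in> borel_measurable P \<Longrightarrow> integral\<^sup>L (q x) g = (\<integral>y. f x y * g y \<partial>P)"
    by metis
  have fZ[measurable]: "f x \<in> borel_measurable Z" if "x \<in> {1..d}" for x
    using f(1)[OF that] by (simp add: measurable_cong_sets[OF setsP refl])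
  have fabs: "\<bar>f x y\<bar> \<le> exp \<alpha>" if "x \<in> {1..d}" for x y
    using f(2,3)[OF that, of y] by (smt (verit) exp_gt_zero divide_pos_pos)
  \<comment> \<open>The weights \<open>a\<close> may be signed: this is applied to
    \<open>p0\<close>, to \<open>\<pi> \<xi>\<close> and to their difference.\<close>
  have mixture: "(\<integral>y. (\<Sum>x=1..d. a x * f x y) * g y \<partial>P) = (\<Sum>x=1..d. a x * (\<integral>y. g y \<partial>q x))"
    if g[measurable]: "g \<in> borel_measurable Z" and C: "\<And>y. y \<in> space Z \<Longrightarrow> \<bar>g y\<bar> \<le> C"
    for a :: "nat \<Rightarrow> real" and g :: "'z \<Rightarrow> real" and C
  proof -
    have i: "integrable P (\<lambda>y. f x y * g y)" if x: "x \<in> {1..d}" for x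
      using fabs[OF x] C fZ[OF x] by (intro integrableP[of _ "exp \<alpha> * C"]) (auto simp: abs_mult intro!: mult_mono)
    have "(\<integral>y. (\<Sum>x=1..d. a x * f x y) * g y \<partial>P) = (\<integral>y. (\<Sum>x=1..d. a x * (f x y * g y)) \<partial>P)"
      by (simp only: sum_distrib_right mult.assoc)
    also have "\<dots> = (\<Sum>x=1..d. a x * (\<integral>y. f x y * g y \<partial>P))"
      using i by (subst Bochner_Integration.integral_sum) auto
    also have "\<dots> = (\<Sum>x=1..d. a x * (\<integral>y. g y \<partial>q x))"
      using f(4) by (intro sum.cong) (auto simp: measurable_cong_sets[OF setsP refl])
    finally show ?thesis .
  qed
  \<comment> \<open>\<open>s\<close> is a density of \<open>P\<close> with respect to itself, but
    put together from separately chosen \<open>f x\<close>, so it is known to equal 1 only almost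
    everywhere.\<close>
  define s where "s y = (\<Sum>x=1..d. p0 x * f x y)" for y
  have s_int: "integrable P s"
  proof (rule integrableP)
    show "\<bar>s y\<bar> \<le> (\<Sum>x=1..d. \<bar>p0 x\<bar> * exp \<alpha>)" for y
      unfolding s_def by (intro order_trans[OF sum_abs] sum_mono) (auto simp: abs_mult intro!: mult_left_mono fabs)
    show "s \<in> borel_measurable Z" unfolding s_def by measurable
  qed
  have s_set: "(\<integral>y. s y * indicat_real A y \<partial>P) = (\<integral>y. 1 * indicat_real A y \<partial>P)" if "A \<in> sets P" for A
  proof -
    have "A \<in> sets Z" using that setsP by simp
    then have "indicat_real A \<in> borel_measurable Z" by simp
    then show ?thesis
      unfolding s_def using mixture[of "indicat_real A" 1 p0] intP[of "indicat_real A" 1]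
      by (simp add: indicator_le_1)
  qed
  have s1: "AE y in P. s y = 1"
  proof -
    have "AE y in P. s y \<le> 1" "AE y in P. 1 \<le> s y"
      using s_set by (auto intro!: AE_le_of_set_integral_le s_int)
    then show ?thesis by eventually_elim auto
  qed
  define v where "v \<xi> x = \<pi> \<xi> x - p0 x" for \<xi> x
  \<comment> \<open>Subtracting 1 costs nothing because \<open>v \<xi>\<close> sums to zero, and it
    makes every coefficient of order \<open>\<alpha>\<close>.\<close>
  define u where "u \<xi> y = (\<Sum>x=1..d. v \<xi> x * (f x y - 1))" for \<xi> y
  define r where "r \<xi> y = (\<Sum>x=1..d. \<pi> \<xi> x * f x y)" for \<xi> y
  have u_meas[measurable]: "u \<xi> \<in> borel_measurable Z" for \<xi> unfolding u_def by measurable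
  have r_meas[measurable]: "r \<xi> \<in> borel_measurable Z" for \<xi> unfolding r_def by measurable
  have u_sq: "(\<Sum>\<xi>\<in>\<Xi>. (u \<xi> y)\<^sup>2) \<le> 4 * \<alpha>\<^sup>2 * (S * card \<Xi>)" for y
  proof -
    \<comment> \<open>Divided by \<open>2 * \<alpha>\<close>, the coefficients at a fixed
      \<open>y\<close> form an admissible \<open>g\<close> for the assumption \<open>S\<close>, the
      same one for all \<open>\<xi>\<close>. The value 0 outside \<open>{1..d}\<close> secures the
      bound for all \<open>x\<close>.\<close>
    define g where "g x = (if x \<in> {1..d} then (f x y - 1) / (2 * \<alpha>) else 0)" for x
    have g: "\<bar>g x\<bar> \<le> 1" for x
      using abs_diff_one_le_two_mult[OF \<alpha>, of "f x y"] f(2,3)[of x y] \<alpha> by (auto simp: g_def field_simps)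
    have "u \<xi> y = 2 * \<alpha> * (\<Sum>x=1..d. (\<pi> \<xi> x - p0 x) * g x)" for \<xi>
      unfolding u_def sum_distrib_left v_def g_def using \<alpha> by (intro sum.cong) auto
    then have "(\<Sum>\<xi>\<in>\<Xi>. (u \<xi> y)\<^sup>2) = 4 * \<alpha>\<^sup>2 * (\<Sum>\<xi>\<in>\<Xi>. (\<Sum>x=1..d. (\<pi> \<xi> x - p0 x) * g x)\<^sup>2)"
      by (simp add: power_mult_distrib sum_distrib_left[symmetric])
    also have "\<dots> \<le> 4 * \<alpha>\<^sup>2 * (S * card \<Xi>)"
      using S[OF g] by (intro mult_left_mono) auto
    finally show ?thesis .
  qed
  have each: "(\<Sum>x=1..d. p0 x * (\<integral>y. ln (h \<xi> y) \<partial>q x))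
      \<le> ln (\<Sum>x=1..d. \<pi> \<xi> x * (\<integral>y. h \<xi> y \<partial>q x)) + (\<integral>y. 3 * (u \<xi> y)\<^sup>2 \<partial>P)"
    and u2_int: "integrable P (\<lambda>y. 3 * (u \<xi> y)\<^sup>2)" if \<xi>: "\<xi> \<in> \<Xi>" for \<xi>
  proof -
    note \<pi>D = prob_simplexD[OF \<pi>[OF \<xi>]]
    note hm[measurable] = h[OF \<xi>]
    have r_lo: "1 / exp \<alpha> \<le> r \<xi> y" for y
    proof -
      have "1 / exp \<alpha> = (\<Sum>x=1..d. \<pi> \<xi> x * (1 / exp \<alpha>))"
        by (simp only: sum_distrib_right[symmetric] \<pi>D(1) mult_1)
      also have "\<dots> \<le> r \<xi> y"
        unfolding r_def using \<pi>D(2) f(2) by (intro sum_mono mult_left_mono) auto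
      finally show ?thesis .
    qed
    have r_hi: "r \<xi> y \<le> exp \<alpha>" for y
    proof -
      have "r \<xi> y \<le> (\<Sum>x=1..d. \<pi> \<xi> x * exp \<alpha>)"
        unfolding r_def using \<pi>D(2) f(3) by (intro sum_mono mult_left_mono) auto
      then show ?thesis by (simp only: sum_distrib_right[symmetric] \<pi>D(1) mult_1)
    qed
    have r_pos: "0 < r \<xi> y" for y using r_lo[of y] by (smt (verit) exp_gt_zero divide_pos_pos)
    have v0: "(\<Sum>x=1..d. v \<xi> x) = 0"
      using \<pi>D(1) p0D(1) by (simp add: v_def sum_subtractf)
    have r_su: "r \<xi> y = s y + u \<xi> y" for y
    proof -
      have "u \<xi> y = (\<Sum>x=1..d. v \<xi> x * f x y) - (\<Sum>x=1..d. v \<xi> x)"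
        by (simp add: u_def algebra_simps sum_subtractf)
      then show ?thesis using v0 by (simp add: r_def s_def v_def algebra_simps sum_subtractf)
    qed
    have u_abs: "\<bar>u \<xi> y\<bar> \<le> (\<Sum>x=1..d. \<bar>v \<xi> x\<bar> * (2 * \<alpha>))" for y
      unfolding u_def by (intro order_trans[OF sum_abs] sum_mono)
        (auto simp: abs_mult intro!: mult_left_mono abs_diff_one_le_two_mult \<alpha> f(2,3))
    have u_int: "integrable P (u \<xi>)" using u_abs by (intro integrableP) auto
    show u2: "integrable P (\<lambda>y. 3 * (u \<xi> y)\<^sup>2)"
    proof (rule integrableP)
      show "\<bar>3 * (u \<xi> y)\<^sup>2\<bar> \<le> 3 * (\<Sum>x=1..d. \<bar>v \<xi> x\<bar> * (2 * \<alpha>))\<^sup>2" for y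
        using power_mono[OF u_abs[of y], of 2] by simp
    qed measurable
    have u0: "(\<integral>y. u \<xi> y \<partial>P) = 0"
    proof -
      have "(\<integral>y. u \<xi> y \<partial>P) = (\<integral>y. (\<Sum>x=1..d. v \<xi> x * f x y) * 1 \<partial>P)"
        using v0 by (simp add: u_def algebra_simps sum_subtractf)
      also have "\<dots> = (\<Sum>x=1..d. v \<xi> x * (\<integral>y. 1 \<partial>q x))" by (rule mixture[of _ 1]) auto
      also have "\<dots> = (\<Sum>x=1..d. v \<xi> x)"
        using qD(1) by (intro sum.cong) (auto simp: prob_space.prob_space)
      finally show ?thesis using v0 by simp
    qed
    have ln_h: "0 \<le> ln (h \<xi> y) \<and> ln (h \<xi> y) \<le> ln b" if "y \<in> space Z" for y
      using bnd[OF \<xi> that] by auto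
    have ln_h_int: "integrable P (\<lambda>y. ln (h \<xi> y))"
      using ln_h by (intro integrableP[of _ "ln b"]) (auto simp: abs_le_iff)
    have ln_r: "- \<alpha> \<le> ln (r \<xi> y) \<and> ln (r \<xi> y) \<le> \<alpha>" for y
    proof -
      have "ln (1 / exp \<alpha>) \<le> ln (r \<xi> y)" "ln (r \<xi> y) \<le> ln (exp \<alpha>)"
        using r_lo r_hi r_pos by (auto simp: ln_le_cancel_iff simp del: ln_exp)
      then show ?thesis by (simp add: ln_div)
    qed
    have ln_r_int: "integrable P (\<lambda>y. ln (r \<xi> y))"
      using ln_r by (intro integrableP[of _ \<alpha>]) (auto simp: abs_le_iff minus_le_iff)
    have hr: "1 / exp \<alpha> \<le> h \<xi> y * r \<xi> y \<and> h \<xi> y * r \<xi> y \<le> b * exp \<alpha>" if "y \<in> space Z" for y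
    proof
      have "1 * (1 / exp \<alpha>) \<le> h \<xi> y * r \<xi> y"
        using bnd[OF \<xi> that] r_lo[of y] r_pos[of y] by (intro mult_mono) auto
      then show "1 / exp \<alpha> \<le> h \<xi> y * r \<xi> y" by simp
      show "h \<xi> y * r \<xi> y \<le> b * exp \<alpha>"
        using bnd[OF \<xi> that] r_hi[of y] r_pos[of y] by (intro mult_mono) auto
    qed
    have "(\<Sum>x=1..d. p0 x * (\<integral>y. ln (h \<xi> y) \<partial>q x)) = (\<integral>y. ln (h \<xi> y) \<partial>P)"
      using ln_h by (intro intP[of _ "ln b", symmetric]) (auto simp: abs_le_iff)
    \<comment> \<open>\<open>u\<close> has mean zero and can be inserted for free. It is then traded
      for \<open>ln r\<close> plus the quadratic error, \<open>ln h + ln r\<close> merges into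
      \<open>ln (h * r)\<close>, and Jensen's inequality leads to the mean of \<open>h * r\<close>
      under \<open>P\<close>, which is the mean of \<open>h\<close> under
      \<open>\<pi> \<xi>\<close>.\<close>
    also have "\<dots> = (\<integral>y. ln (h \<xi> y) \<partial>P) + (\<integral>y. u \<xi> y \<partial>P)" using u0 by simp
    also have "\<dots> \<le> (\<integral>y. ln (h \<xi> y) \<partial>P) + (\<integral>y. ln (r \<xi> y) + 3 * (u \<xi> y)\<^sup>2 \<partial>P)"
    proof (intro add_left_mono integral_mono_AE)
      show "AE y in P. u \<xi> y \<le> ln (r \<xi> y) + 3 * (u \<xi> y)\<^sup>2"
        using s1
      proof eventually_elim
        case (elim y)
        have "exp (- 1) \<le> 1 / exp \<alpha>" using \<alpha> by (simp add: exp_minus field_simps)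
        then have "exp (- 1) \<le> 1 + u \<xi> y" using r_lo[of y] r_su[of y] elim by simp
        from ln_one_plus_ge_quadratic[OF this] show ?case using r_su[of y] elim by simp
      qed
    qed (use u_int ln_r_int u2 in auto)
    also have "\<dots> = (\<integral>y. ln (h \<xi> y) + ln (r \<xi> y) \<partial>P) + (\<integral>y. 3 * (u \<xi> y)\<^sup>2 \<partial>P)"
      using ln_h_int ln_r_int u2 by simp
    also have "(\<integral>y. ln (h \<xi> y) + ln (r \<xi> y) \<partial>P) = (\<integral>y. ln (h \<xi> y * r \<xi> y) \<partial>P)"
      by (intro Bochner_Integration.integral_cong) (use bnd[OF \<xi>] r_pos in \<open>fastforce simp: spaceP ln_mult_pos\<close>)+
    also have "\<dots> \<le> ln (\<integral>y. h \<xi> y * r \<xi> y \<partial>P)"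
    proof (rule P.expectation_ln_le[where a="1 / exp \<alpha>"])
      show "(\<lambda>y. h \<xi> y * r \<xi> y) \<in> borel_measurable P" by measurable
    qed (use hr in \<open>auto simp: spaceP\<close>)
    also have "(\<integral>y. h \<xi> y * r \<xi> y \<partial>P) = (\<Sum>x=1..d. \<pi> \<xi> x * (\<integral>y. h \<xi> y \<partial>q x))"
      unfolding r_def mult.commute[of "h \<xi> _"]
      using bnd[OF \<xi>] by (intro mixture[of _ b]) fastforce+
    finally show "(\<Sum>x=1..d. p0 x * (\<integral>y. ln (h \<xi> y) \<partial>q x))
      \<le> ln (\<Sum>x=1..d. \<pi> \<xi> x * (\<integral>y. h \<xi> y \<partial>q x)) + (\<integral>y. 3 * (u \<xi> y)\<^sup>2 \<partial>P)" by simp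
  qed
  \<comment> \<open>The sum goes inside the integral because it is the sum of the squares that
    \<open>u_sq\<close> bounds pointwise.\<close>
  have "(\<Sum>\<xi>\<in>\<Xi>. \<integral>y. 3 * (u \<xi> y)\<^sup>2 \<partial>P) = (\<integral>y. (\<Sum>\<xi>\<in>\<Xi>. 3 * (u \<xi> y)\<^sup>2) \<partial>P)"
    using u2_int by (intro Bochner_Integration.integral_sum[symmetric])
  also have "\<dots> \<le> 3 * (4 * \<alpha>\<^sup>2 * (S * card \<Xi>))"
    using u2_int u_sq by (intro P.integral_le_const Bochner_Integration.integrable_sum AE_I2)
      (auto simp: sum_distrib_left[symmetric] mult_ac)
  finally have "(\<Sum>\<xi>\<in>\<Xi>. \<integral>y. 3 * (u \<xi> y)\<^sup>2 \<partial>P) \<le> 12 * \<alpha>\<^sup>2 * S * card \<Xi>" by simp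
  moreover have "(\<Sum>\<xi>\<in>\<Xi>. \<Sum>x=1..d. p0 x * (\<integral>y. ln (h \<xi> y) \<partial>q x))
      \<le> (\<Sum>\<xi>\<in>\<Xi>. ln (\<Sum>x=1..d. \<pi> \<xi> x * (\<integral>y. h \<xi> y \<partial>q x)) + (\<integral>y. 3 * (u \<xi> y)\<^sup>2 \<partial>P))"
    by (intro sum_mono each)
  ultimately show ?thesis by (simp only: sum.distrib)
qed

subsection \<open>The law of the private data\<close>

locale ldp_mechanism =
  fixes Z :: "'z measure" and Q :: "nat \<Rightarrow> nat \<Rightarrow> (nat \<Rightarrow> 'z) \<Rightarrow> 'z measure"
    and \<alpha> :: real and n d :: nat
  assumes mech: "(Z, Q) \<in> ldp_mechanisms \<alpha> n d"
begin

abbreviation history :: "nat \<Rightarrow> (nat \<Rightarrow> 'z) measure" where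
  "history i \<equiv> (\<Pi>\<^sub>M k\<in>{1..i}. Z)"

abbreviation law :: "(nat \<Rightarrow> real) \<Rightarrow> nat \<Rightarrow> (nat \<Rightarrow> 'z) measure" where
  "law p i \<equiv> private_law (Z, Q) d p i"

lemma kernel_measurable:
  assumes "i < n" "x \<in> {1..d}"
  shows "Q (Suc i) x \<in> history i \<rightarrow>\<^sub>M prob_algebra Z"
proof -
  have "Suc i \<in> {1..n}" using assms by auto
  then have "Q (Suc i) x \<in> (\<Pi>\<^sub>M k\<in>{1..<Suc i}. Z) \<rightarrow>\<^sub>M prob_algebra Z"
    using mech assms unfolding ldp_mechanisms_def by blast
  then show ?thesis by (simp only: atLeastLessThanSuc_atLeastAtMost)
qed

lemma kernel_prob_algebra:
  assumes "i < n" "x \<in> {1..d}" "z \<in> space (history i)"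
  shows "Q (Suc i) x z \<in> space (prob_algebra Z)"
  using measurable_space[OF kernel_measurable] assms by blast

lemma kernel_ldp:
  assumes "i < n" "z \<in> space (history i)" "x \<in> {1..d}" "x' \<in> {1..d}" "A \<in> sets Z"
  shows "measure (Q (Suc i) x z) A \<le> exp \<alpha> * measure (Q (Suc i) x' z) A"
proof -
  have "Suc i \<in> {1..n}" using assms by auto
  moreover have "z \<in> space (\<Pi>\<^sub>M k\<in>{1..<Suc i}. Z)"
    using assms(2) by (simp only: atLeastLessThanSuc_atLeastAtMost)
  ultimately show ?thesis
    using mech assms(3-5) unfolding ldp_mechanisms_def by blast
qed

lemma extend_history_measurable [measurable]:
  "(\<lambda>(z, y). z(Suc i := y)) \<in> history i \<Otimes>\<^sub>M Z \<rightarrow>\<^sub>M history (Suc i)"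
  using measurable_add_dim[of "Suc i" "{1..i}" "\<lambda>_. Z"] by (simp add: atLeastAtMostSuc_conv)

lemma extend_history_measurable_snd:
  "z \<in> space (history i) \<Longrightarrow> (\<lambda>y. z(Suc i := y)) \<in> Z \<rightarrow>\<^sub>M history (Suc i)"
  using measurable_compose[OF measurable_Pair1' extend_history_measurable] by simp

text \<open>The inner part of the recursion of \<open>private_law\<close>, at a fixed
  \<open>x\<close>. Splitting it off allows measurability in the history to be shown for each
  \<open>x\<close> before \<open>x\<close> is averaged out.\<close>

definition extend :: "nat \<Rightarrow> (nat \<Rightarrow> 'z) \<Rightarrow> nat \<Rightarrow> (nat \<Rightarrow> 'z) measure" where
  "extend i z x = Q (Suc i) x z \<bind> (\<lambda>y. return (history (Suc i)) (z(Suc i := y)))"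

lemma extend_measurable:
  assumes "i < n" "x \<in> {1..d}"
  shows "(\<lambda>z. extend i z x) \<in> history i \<rightarrow>\<^sub>M prob_algebra (history (Suc i))"
  unfolding extend_def
proof (rule measurable_bind_prob_space2[OF kernel_measurable[OF assms]])
  show "(\<lambda>(z, y). return (history (Suc i)) (z(Suc i := y))) \<in> history i \<Otimes>\<^sub>M Z \<rightarrow>\<^sub>M prob_algebra (history (Suc i))"
    using measurable_compose[OF extend_history_measurable measurable_return_prob_space]
    by (simp add: case_prod_unfold)
qed

lemma integral_extend:
  fixes h :: "(nat \<Rightarrow> 'z) \<Rightarrow> real"
  assumes i: "i < n" and x: "x \<in> {1..d}" and z: "z \<in> space (history i)"
    and h[measurable]: "h \<in> borel_measurable (history (Suc i))"
    and bnd: "\<And>w. w \<in> space (history (Suc i)) \<Longrightarrow> \<bar>h w\<bar> \<le> C"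
  shows "(\<integral>w. h w \<partial>extend i z x) = (\<integral>y. h (z(Suc i := y)) \<partial>Q (Suc i) x z)"
proof -
  have q: "prob_space (Q (Suc i) x z)" "sets (Q (Suc i) x z) = sets Z"
    using kernel_prob_algebra[OF i x z] by (auto simp: space_prob_algebra)
  note upd = extend_history_measurable_snd[OF z]
  have upd': "(\<lambda>y. z(Suc i := y)) \<in> Q (Suc i) x z \<rightarrow>\<^sub>M history (Suc i)"
    using upd by (simp add: measurable_cong_sets[OF q(2) refl])
  have "(\<integral>w. h w \<partial>extend i z x) =
      (\<integral>y. (\<integral>w. h w \<partial>return (history (Suc i)) (z(Suc i := y))) \<partial>Q (Suc i) x z)"
    unfolding extend_def
  proof (rule integral_bind[where K="history (Suc i)" and B'=1])
    show "(\<lambda>y. return (history (Suc i)) (z(Suc i := y))) \<in> Q (Suc i) x z \<rightarrow>\<^sub>M subprob_algebra (history (Suc i))"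
      by (rule measurable_compose[OF upd' measurable_prob_algebraD[OF measurable_return_prob_space]])
    show "finite_measure (Q (Suc i) x z)" using q(1) by (simp add: prob_space_def)
    show "AE y in Q (Suc i) x z. emeasure (return (history (Suc i)) (z(Suc i := y)))
        (space (return (history (Suc i)) (z(Suc i := y)))) \<le> ennreal 1"
      using measurable_space[OF upd'] by (intro AE_I2) (auto intro!: prob_space.emeasure_le_1 prob_space_return)
  qed (use bnd h in auto)
  also have "\<dots> = (\<integral>y. h (z(Suc i := y)) \<partial>Q (Suc i) x z)"
    by (intro Bochner_Integration.integral_cong refl integral_return) (use measurable_space[OF upd'] h in auto)
  finally show ?thesis .
qed

text \<open>Since \<open>x\<close> ranges over a finite discrete space, joint measurability in
  \<open>x\<close> and \<open>z\<close> reduces to measurability in \<open>z\<close> for each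
  \<open>x\<close>.\<close>

lemma step_measurable:
  assumes p: "p \<in> prob_simplex d" and i: "i < n"
  shows "(\<lambda>z. data_law d p \<bind> extend i z) \<in> history i \<rightarrow>\<^sub>M prob_algebra (history (Suc i))"
proof (rule measurable_bind_prob_space2[where N="count_space {1..d}"])
  show "(\<lambda>z. data_law d p) \<in> history i \<rightarrow>\<^sub>M prob_algebra (count_space {1..d})"
    using prob_space_data_law[OF p] by (intro measurable_const) (simp add: space_prob_algebra sets_data_law)
  have "(\<lambda>(x, z). extend i z x) \<in> count_space {1..d} \<Otimes>\<^sub>M history i \<rightarrow>\<^sub>M prob_algebra (history (Suc i))"
    by (rule measurable_pair_measure_countable1) (use extend_measurable[OF i] in auto)
  then show "(\<lambda>(z, x). extend i z x) \<in> history i \<Otimes>\<^sub>M count_space {1..d} \<rightarrow>\<^sub>M prob_algebra (history (Suc i))"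
    by (subst measurable_pair_swap_iff) (simp add: case_prod_unfold)
qed

lemma law_Suc: "law p (Suc i) = law p i \<bind> (\<lambda>z. data_law d p \<bind> extend i z)"
  by (simp add: extend_def[abs_def])

lemma law_prob_algebra:
  assumes p: "p \<in> prob_simplex d"
  shows "i \<le> n \<Longrightarrow> law p i \<in> space (prob_algebra (history i))"
proof (induction i)
  case 0
  have "(\<lambda>_. undefined) \<in> space (history 0)" by (simp add: space_PiM)
  then show ?case by (simp add: space_prob_algebra prob_space_return)
next
  case (Suc i)
  \<comment> \<open>The composition rule is about kernels; viewing the law as a constant kernel on a
    one-point space makes it apply to a single measure.\<close>
  have "(\<lambda>_. law p i \<bind> (\<lambda>z. data_law d p \<bind> extend i z)) \<in> count_space (UNIV :: unit set) \<rightarrow>\<^sub>M prob_algebra (history (Suc i))"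
    by (rule measurable_bind_prob_space[where N="history i"]) (use Suc step_measurable[OF p] in auto)
  from measurable_space[OF this, of "()"] show ?case by (simp only: law_Suc) simp
qed

text \<open>The tower property: given the history, the last observation is integrated out first. The
  induction over the sample peels off observations in this way.\<close>

lemma integral_law_Suc:
  fixes h :: "(nat \<Rightarrow> 'z) \<Rightarrow> real"
  assumes p: "p \<in> prob_simplex d" and i: "i < n"
    and h[measurable]: "h \<in> borel_measurable (history (Suc i))"
    and bnd: "\<And>w. w \<in> space (history (Suc i)) \<Longrightarrow> \<bar>h w\<bar> \<le> C"
  shows "(\<integral>w. h w \<partial>law p (Suc i)) =
    (\<integral>z. (\<Sum>x=1..d. p x * (\<integral>y. h (z(Suc i := y)) \<partial>Q (Suc i) x z)) \<partial>law p i)"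
proof -
  have L: "prob_space (law p i)" "sets (law p i) = sets (history i)"
    using law_prob_algebra[OF p, of i] i by (auto simp: space_prob_algebra)
  note spaceL = sets_eq_imp_space_eq[OF L(2)]
  have ext: "extend i z x \<in> space (prob_algebra (history (Suc i)))"
    if "z \<in> space (history i)" "x \<in> {1..d}" for z x
    using measurable_space[OF extend_measurable[OF i that(2)] that(1)] .
  have "(\<integral>w. h w \<partial>law p (Suc i)) = (\<integral>z. (\<integral>w. h w \<partial>(data_law d p \<bind> extend i z)) \<partial>law p i)"
    unfolding law_Suc
  proof (rule integral_bind[where K="history (Suc i)" and B'=1])
    show "(\<lambda>z. data_law d p \<bind> extend i z) \<in> law p i \<rightarrow>\<^sub>M subprob_algebra (history (Suc i))"
      using measurable_prob_algebraD[OF step_measurable[OF p i]] by (simp add: measurable_cong_sets[OF L(2) refl])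
    show "finite_measure (law p i)" using L(1) by (simp add: prob_space_def)
    show "AE z in law p i. emeasure (data_law d p \<bind> extend i z)
        (space (data_law d p \<bind> extend i z)) \<le> ennreal 1"
      using measurable_space[OF step_measurable[OF p i]]
      by (intro AE_I2) (auto simp: spaceL space_prob_algebra intro: prob_space.emeasure_le_1)
  qed (use bnd h in auto)
  also have "\<dots> = (\<integral>z. (\<Sum>x=1..d. p x * (\<integral>w. h w \<partial>extend i z x)) \<partial>law p i)"
    by (intro Bochner_Integration.integral_cong refl integral_bind_data_law[OF p _ h bnd])
       (use ext spaceL in auto)
  also have "\<dots> = (\<integral>z. (\<Sum>x=1..d. p x * (\<integral>y. h (z(Suc i := y)) \<partial>Q (Suc i) x z)) \<partial>law p i)"
    using integral_extend[OF i _ _ h bnd] spaceL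
    by (intro Bochner_Integration.integral_cong refl sum.cong) auto
  finally show ?thesis .
qed

text \<open>The conditional expectation of \<open>h\<close> given the first \<open>i\<close>
  observations when the next data point has law \<open>p\<close>.\<close>

definition predict :: "(nat \<Rightarrow> real) \<Rightarrow> nat \<Rightarrow> ((nat \<Rightarrow> 'z) \<Rightarrow> real) \<Rightarrow> (nat \<Rightarrow> 'z) \<Rightarrow> real" where
  "predict p i h z = (\<Sum>x=1..d. p x * (\<integral>y. h (z(Suc i := y)) \<partial>Q (Suc i) x z))"

lemma predict_measurable:
  assumes i: "i < n" and h: "h \<in> borel_measurable (history (Suc i))"
    and bnd: "\<And>w. w \<in> space (history (Suc i)) \<Longrightarrow> \<bar>h w\<bar> \<le> C"
  shows "predict p i h \<in> borel_measurable (history i)"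
proof -
  have "(\<lambda>z. \<integral>y. h (z(Suc i := y)) \<partial>Q (Suc i) x z) \<in> borel_measurable (history i)" if x: "x \<in> {1..d}" for x
  proof -
    have "(\<lambda>z. \<integral>w. h w \<partial>extend i z x) \<in> borel_measurable (history i)"
      by (rule measurable_compose[OF measurable_prob_algebraD[OF extend_measurable[OF i x]]
            integral_measurable_subprob_algebra[OF h]])
    then show ?thesis
      by (rule measurable_cong[THEN iffD1, rotated]) (rule integral_extend[OF i x _ h bnd])
  qed
  then show ?thesis unfolding predict_def[abs_def] by (intro borel_measurable_sum borel_measurable_times borel_measurable_const)
qed

text \<open>Averaging preserves bounds, so the induction over the sample can keep the range from 1
  to \<open>b\<close> unchanged.\<close>

lemma predict_bounds:
  assumes p: "p \<in> prob_simplex d" and i: "i < n" and h: "h \<in> borel_measurable (history (Suc i))"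
    and bnd: "\<And>w. w \<in> space (history (Suc i)) \<Longrightarrow> a \<le> h w \<and> h w \<le> b"
    and z: "z \<in> space (history i)"
  shows "a \<le> predict p i h z \<and> predict p i h z \<le> b"
proof -
  note pD = prob_simplexD[OF p]
  have *: "a \<le> (\<integral>y. h (z(Suc i := y)) \<partial>Q (Suc i) x z) \<and> (\<integral>y. h (z(Suc i := y)) \<partial>Q (Suc i) x z) \<le> b"
    if x: "x \<in> {1..d}" for x
  proof -
    have q: "prob_space (Q (Suc i) x z)" "sets (Q (Suc i) x z) = sets Z"
      using kernel_prob_algebra[OF i x z] by (auto simp: space_prob_algebra)
    interpret prob_space "Q (Suc i) x z" by (rule q)
    have upd: "(\<lambda>y. z(Suc i := y)) \<in> Q (Suc i) x z \<rightarrow>\<^sub>M history (Suc i)"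
      using extend_history_measurable_snd[OF z] by (simp add: measurable_cong_sets[OF q(2) refl])
    have hb: "a \<le> h (z(Suc i := y))" "h (z(Suc i := y)) \<le> b" if "y \<in> space (Q (Suc i) x z)" for y
      using bnd[OF measurable_space[OF upd that]] by auto
    have "\<bar>h (z(Suc i := y))\<bar> \<le> \<bar>a\<bar> + \<bar>b\<bar>" if "y \<in> space (Q (Suc i) x z)" for y
      using hb[OF that] by linarith
    then have int: "integrable (Q (Suc i) x z) (\<lambda>y. h (z(Suc i := y)))"
      by (intro integrable_const_bound[of _ "\<bar>a\<bar> + \<bar>b\<bar>"] AE_I2 measurable_compose[OF upd h]) auto
    show ?thesis using hb by (auto intro!: integral_ge_const integral_le_const int AE_I2)
  qed
  have "a = (\<Sum>x=1..d. p x * a)" "b = (\<Sum>x=1..d. p x * b)"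
    using pD(1) by (simp_all add: sum_distrib_right[symmetric])
  moreover have "(\<Sum>x=1..d. p x * a) \<le> predict p i h z" "predict p i h z \<le> (\<Sum>x=1..d. p x * b)"
    unfolding predict_def using * pD(2) by (auto intro!: sum_mono mult_left_mono)
  ultimately show ?thesis by simp
qed

section \<open>Information carried by the whole sample\<close>

lemma integrable_law:
  fixes h :: "(nat \<Rightarrow> 'z) \<Rightarrow> real"
  assumes p: "p \<in> prob_simplex d" and i: "i \<le> n" and h: "h \<in> borel_measurable (history i)"
    and bnd: "\<And>w. w \<in> space (history i) \<Longrightarrow> \<bar>h w\<bar> \<le> C"
  shows "integrable (law p i) h"
proof -
  have L: "prob_space (law p i)" "sets (law p i) = sets (history i)"
    using law_prob_algebra[OF p i] by (auto simp: space_prob_algebra)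
  interpret prob_space "law p i" by (rule L)
  show ?thesis
    using bnd h sets_eq_imp_space_eq[OF L(2)]
    by (intro integrable_const_bound[of _ C] AE_I2) (auto simp: measurable_cong_sets[OF L(2) refl])
qed

text \<open>A chain rule for relative entropy in dual form, by induction on \<open>i\<close> with
  the same increment for each observation. The functions \<open>h\<close> vary in the induction
  because its hypothesis is applied to their conditional expectations.\<close>

lemma information_bound:
  fixes \<pi> :: "'x \<Rightarrow> nat \<Rightarrow> real" and h :: "'x \<Rightarrow> (nat \<Rightarrow> 'z) \<Rightarrow> real" and S :: real
  assumes \<alpha>: "0 < \<alpha>" "\<alpha> \<le> 1"
    and p0: "p0 \<in> prob_simplex d" and \<pi>: "\<And>\<xi>. \<xi> \<in> \<Xi> \<Longrightarrow> \<pi> \<xi> \<in> prob_simplex d"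
    and S: "\<And>g. (\<And>x. \<bar>g x\<bar> \<le> 1) \<Longrightarrow>
              (\<Sum>\<xi>\<in>\<Xi>. (\<Sum>x=1..d. (\<pi> \<xi> x - p0 x) * g x)\<^sup>2) \<le> S * card \<Xi>"
  shows "\<lbrakk>i \<le> n; \<And>\<xi>. \<xi> \<in> \<Xi> \<Longrightarrow> h \<xi> \<in> borel_measurable (history i);
      \<And>\<xi> z. \<xi> \<in> \<Xi> \<Longrightarrow> z \<in> space (history i) \<Longrightarrow> 1 \<le> h \<xi> z \<and> h \<xi> z \<le> b\<rbrakk> \<Longrightarrow>
    (\<Sum>\<xi>\<in>\<Xi>. \<integral>z. ln (h \<xi> z) \<partial>law p0 i)
      \<le> real i * (12 * \<alpha>\<^sup>2 * S * card \<Xi>) + (\<Sum>\<xi>\<in>\<Xi>. ln (\<integral>z. h \<xi> z \<partial>law (\<pi> \<xi>) i))"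
proof (induction i arbitrary: h)
  case 0
  \<comment> \<open>Before the first observation the law is a point mass, so \<open>ln\<close>
    commutes with the integral and both sides agree.\<close>
  have "(\<lambda>_. undefined) \<in> space (history 0)" by (simp add: space_PiM)
  then have *: "(\<integral>z. g z \<partial>law p 0) = g (\<lambda>_. undefined)" if "g \<in> borel_measurable (history 0)" for g :: "_ \<Rightarrow> real" and p
    using that by (simp add: integral_return)
  have "(\<lambda>z. ln (h \<xi> z)) \<in> borel_measurable (history 0)" if "\<xi> \<in> \<Xi>" for \<xi>
    using 0(2)[OF that] by measurable
  then show ?case using 0(2) by (simp add: * del: private_law.simps)
next
  case (Suc i)
  note h = Suc.prems(2) and hb = Suc.prems(3)
  have i: "i < n" "i \<le> n" using Suc.prems(1) by auto
  have L: "prob_space (law p i)" "sets (law p i) = sets (history i)" if "p \<in> prob_simplex d" for p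
    using law_prob_algebra[OF that i(2)] by (auto simp: space_prob_algebra)
  interpret L0: prob_space "law p0 i" by (rule L(1)[OF p0])
  have space0: "space (law p0 i) = space (history i)" by (rule sets_eq_imp_space_eq[OF L(2)[OF p0]])
  \<comment> \<open>\<open>h\<close> is averaged under the alternative and \<open>ln h\<close> under
    \<open>p0\<close>: the one-step bound compares precisely these two at each history. Then
    \<open>e\<close> and \<open>ln h'\<close> are both integrated under \<open>p0\<close>, which
    lets the sum over \<open>\<xi>\<close> pass under a single integral.\<close>
  define h' where "h' \<xi> = predict (\<pi> \<xi>) i (h \<xi>)" for \<xi>
  define e where "e \<xi> = predict p0 i (\<lambda>z. ln (h \<xi> z))" for \<xi>
  have h_abs: "\<bar>h \<xi> z\<bar> \<le> b" "\<bar>ln (h \<xi> z)\<bar> \<le> ln b" "0 \<le> ln (h \<xi> z) \<and> ln (h \<xi> z) \<le> ln b"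
    if "\<xi> \<in> \<Xi>" "z \<in> space (history (Suc i))" for \<xi> z
    using hb[OF that] by auto
  have ln_h: "(\<lambda>z. ln (h \<xi> z)) \<in> borel_measurable (history (Suc i))" if "\<xi> \<in> \<Xi>" for \<xi>
    using h[OF that] by measurable
  have h': "h' \<xi> \<in> borel_measurable (history i)" if "\<xi> \<in> \<Xi>" for \<xi>
    unfolding h'_def by (rule predict_measurable[OF i(1) h[OF that] h_abs(1)[OF that]])
  have h'b: "1 \<le> h' \<xi> z \<and> h' \<xi> z \<le> b" if "\<xi> \<in> \<Xi>" "z \<in> space (history i)" for \<xi> z
    unfolding h'_def by (rule predict_bounds[OF \<pi>[OF that(1)] i(1) h[OF that(1)] hb[OF that(1)] that(2)])
  have e: "e \<xi> \<in> borel_measurable (history i)" if "\<xi> \<in> \<Xi>" for \<xi>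
    unfolding e_def by (rule predict_measurable[OF i(1) ln_h[OF that] h_abs(2)[OF that]])
  have eb: "0 \<le> e \<xi> z \<and> e \<xi> z \<le> ln b" if "\<xi> \<in> \<Xi>" "z \<in> space (history i)" for \<xi> z
    unfolding e_def by (rule predict_bounds[OF p0 i(1) ln_h[OF that(1)] h_abs(3)[OF that(1)] that(2)])
  have e_int: "integrable (law p0 i) (e \<xi>)" if "\<xi> \<in> \<Xi>" for \<xi>
    using eb[OF that] by (intro integrable_law[OF p0 i(2) e[OF that], of "ln b"]) auto
  have ln_h'_int: "integrable (law p0 i) (\<lambda>z. ln (h' \<xi> z))" if "\<xi> \<in> \<Xi>" for \<xi>
  proof (rule integrable_law[OF p0 i(2), of _ "ln b"])
    show "(\<lambda>z. ln (h' \<xi> z)) \<in> borel_measurable (history i)" using h'[OF that] by measurable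
    show "\<bar>ln (h' \<xi> z)\<bar> \<le> ln b" if "z \<in> space (history i)" for z
      using h'b[OF \<open>\<xi> \<in> \<Xi>\<close> that] by auto
  qed
  let ?k = "12 * \<alpha>\<^sup>2 * S * card \<Xi>"
  have one_step: "(\<Sum>\<xi>\<in>\<Xi>. e \<xi> z) \<le> ?k + (\<Sum>\<xi>\<in>\<Xi>. ln (h' \<xi> z))" if z: "z \<in> space (history i)" for z
    unfolding e_def h'_def predict_def
  proof (rule one_step_information_bound[OF _ _ \<alpha> p0 \<pi> S])
    show "(\<lambda>y. h \<xi> (z(Suc i := y))) \<in> borel_measurable Z" if "\<xi> \<in> \<Xi>" for \<xi>
      by (rule measurable_compose[OF extend_history_measurable_snd[OF z] h[OF that]])
    show "1 \<le> h \<xi> (z(Suc i := y)) \<and> h \<xi> (z(Suc i := y)) \<le> b" if "\<xi> \<in> \<Xi>" "y \<in> space Z" for \<xi> y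
      by (rule hb[OF that(1) measurable_space[OF extend_history_measurable_snd[OF z] that(2)]])
    show "Q (Suc i) x z \<in> space (prob_algebra Z)" if "x \<in> {1..d}" for x
      by (rule kernel_prob_algebra[OF i(1) that z])
    show "measure (Q (Suc i) x z) A \<le> exp \<alpha> * measure (Q (Suc i) x' z) A"
      if "x \<in> {1..d}" "x' \<in> {1..d}" "A \<in> sets Z" for x x' A
      by (rule kernel_ldp[OF i(1) z that])
  qed
  have "(\<Sum>\<xi>\<in>\<Xi>. \<integral>z. ln (h \<xi> z) \<partial>law p0 (Suc i)) = (\<Sum>\<xi>\<in>\<Xi>. \<integral>z. e \<xi> z \<partial>law p0 i)"
    unfolding e_def predict_def
    by (intro sum.cong refl integral_law_Suc[OF p0 i(1) ln_h h_abs(2)])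
  also have "\<dots> = (\<integral>z. (\<Sum>\<xi>\<in>\<Xi>. e \<xi> z) \<partial>law p0 i)"
    using e_int by (intro Bochner_Integration.integral_sum[symmetric])
  also have "\<dots> \<le> (\<integral>z. ?k + (\<Sum>\<xi>\<in>\<Xi>. ln (h' \<xi> z)) \<partial>law p0 i)"
    using e_int ln_h'_int one_step by (intro integral_mono) (auto simp: space0)
  also have "\<dots> = ?k + (\<Sum>\<xi>\<in>\<Xi>. \<integral>z. ln (h' \<xi> z) \<partial>law p0 i)"
    using ln_h'_int by (simp add: L0.prob_space)
  \<comment> \<open>The induction hypothesis at \<open>h'\<close> changes the law of the history
    from \<open>p0\<close> to \<open>\<pi> \<xi>\<close>.\<close>
  also have "\<dots> \<le> ?k + (real i * ?k + (\<Sum>\<xi>\<in>\<Xi>. ln (\<integral>z. h' \<xi> z \<partial>law (\<pi> \<xi>) i)))"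
    by (intro add_left_mono Suc.IH[OF i(2) h' h'b])
  also have "(\<Sum>\<xi>\<in>\<Xi>. ln (\<integral>z. h' \<xi> z \<partial>law (\<pi> \<xi>) i)) = (\<Sum>\<xi>\<in>\<Xi>. ln (\<integral>z. h \<xi> z \<partial>law (\<pi> \<xi>) (Suc i)))"
    unfolding h'_def predict_def
    by (intro sum.cong refl arg_cong[where f=ln] integral_law_Suc[OF \<pi> i(1) h h_abs(1), symmetric])
  finally show ?case by (simp add: algebra_simps)
qed

text \<open>With \<open>\<psi> = 1 - \<phi>\<close>, \<open>ln (1 + t * \<psi>)\<close> is at least
  \<open>t * \<psi> - t\<^sup>2\<close>, and the logarithm of the mean of
  \<open>1 + t * \<psi>\<close> under an alternative is at most \<open>t\<close> times the mean of
  \<open>\<psi>\<close>. Division by \<open>t\<close> leaves a linearization error \<open>t\<close>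
  and an information cost of order \<open>1 / t\<close>, to be balanced by the choice of
  \<open>t\<close>.\<close>

lemma average_risk_lower_bound:
  fixes \<pi> :: "'x \<Rightarrow> nat \<Rightarrow> real" and S :: real
  assumes \<alpha>: "0 < \<alpha>" "\<alpha> \<le> 1"
    and p0: "p0 \<in> prob_simplex d" and \<pi>: "\<And>\<xi>. \<xi> \<in> \<Xi> \<Longrightarrow> \<pi> \<xi> \<in> prob_simplex d"
    and S: "\<And>g. (\<And>x. \<bar>g x\<bar> \<le> 1) \<Longrightarrow>
              (\<Sum>\<xi>\<in>\<Xi>. (\<Sum>x=1..d. (\<pi> \<xi> x - p0 x) * g x)\<^sup>2) \<le> S * card \<Xi>"
    and \<phi>: "\<phi> \<in> tests (Z, Q) n" and t: "0 < t" "t \<le> 1"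
  shows "card \<Xi> * (1 - 12 * n * \<alpha>\<^sup>2 * S / t - t) \<le>
    (\<Sum>\<xi>\<in>\<Xi>. expect (Z, Q) n d p0 \<phi> + expect (Z, Q) n d (\<pi> \<xi>) (\<lambda>z. 1 - \<phi> z))"
proof -
  have \<phi>m: "\<phi> \<in> borel_measurable (history n)" and \<phi>b: "\<And>z. z \<in> space (history n) \<Longrightarrow> 0 \<le> \<phi> z \<and> \<phi> z \<le> 1"
    using \<phi> by (auto simp: tests_def)
  define \<psi> where "\<psi> z = 1 - \<phi> z" for z
  have \<psi>m[measurable]: "\<psi> \<in> borel_measurable (history n)" unfolding \<psi>_def using \<phi>m by measurable
  have \<psi>b: "0 \<le> \<psi> z \<and> \<psi> z \<le> 1" if "z \<in> space (history n)" for z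
    using \<phi>b[OF that] by (auto simp: \<psi>_def)
  define E where "E p = (\<integral>z. \<psi> z \<partial>law p n)" for p
  have L: "prob_space (law p n)" "space (law p n) = space (history n)" if "p \<in> prob_simplex d" for p
    using law_prob_algebra[OF that, of n] by (auto simp: space_prob_algebra dest: sets_eq_imp_space_eq)
  have \<psi>_int: "integrable (law p n) \<psi>" if "p \<in> prob_simplex d" for p
    using \<psi>b \<psi>m by (intro integrable_law[OF that, where C=1]) auto
  have E0: "0 \<le> E p" if "p \<in> prob_simplex d" for p
    unfolding E_def using \<psi>b L(2)[OF that] by (intro integral_nonneg_AE AE_I2) auto
  have \<phi>_E: "expect (Z, Q) n d p0 \<phi> = 1 - E p0"
  proof -
    interpret prob_space "law p0 n" by (rule L(1)[OF p0])
    have "(\<integral>z. \<phi> z \<partial>law p0 n) = (\<integral>z. 1 - \<psi> z \<partial>law p0 n)" by (simp add: \<psi>_def)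
    also have "\<dots> = 1 - E p0" using \<psi>_int[OF p0] by (simp add: E_def prob_space)
    finally show ?thesis by (simp add: expect_def)
  qed
  let ?k = "12 * \<alpha>\<^sup>2 * S * card \<Xi>"
  have lower: "t * E p0 - t\<^sup>2 \<le> (\<integral>z. ln (1 + t * \<psi> z) \<partial>law p0 n)"
  proof -
    interpret prob_space "law p0 n" by (rule L(1)[OF p0])
    have "t * E p0 - t\<^sup>2 = (\<integral>z. t * \<psi> z - t\<^sup>2 \<partial>law p0 n)"
      using \<psi>_int[OF p0] by (simp add: E_def prob_space)
    also have "\<dots> \<le> (\<integral>z. ln (1 + t * \<psi> z) \<partial>law p0 n)"
    proof (rule integral_mono)
      show "integrable (law p0 n) (\<lambda>z. ln (1 + t * \<psi> z))"
      proof (rule integrable_law[OF p0, of n _ "ln (1 + t)"])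
        show "\<bar>ln (1 + t * \<psi> z)\<bar> \<le> ln (1 + t)" if "z \<in> space (history n)" for z
          using \<psi>b[OF that] t by (simp add: mult_left_le add_pos_nonneg)
        show "(\<lambda>z. ln (1 + t * \<psi> z)) \<in> borel_measurable (history n)" by measurable
      qed simp
      show "t * \<psi> z - t\<^sup>2 \<le> ln (1 + t * \<psi> z)" if "z \<in> space (law p0 n)" for z
      proof -
        have b: "0 \<le> \<psi> z" "\<psi> z \<le> 1" using \<psi>b[of z] that L(2)[OF p0] by auto
        have "(t * \<psi> z)\<^sup>2 \<le> t\<^sup>2" using b t by (intro power_mono) (auto simp: mult_left_le)
        moreover have "t * \<psi> z - (t * \<psi> z)\<^sup>2 \<le> ln (1 + t * \<psi> z)"
          using b t by (intro ln_one_plus_pos_lower_bound) (auto simp: mult_le_one)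
        ultimately show ?thesis by linarith
      qed
    qed (use \<psi>_int[OF p0] in auto)
    finally show ?thesis .
  qed
  have upper: "ln (\<integral>z. 1 + t * \<psi> z \<partial>law (\<pi> \<xi>) n) \<le> t * E (\<pi> \<xi>)" if "\<xi> \<in> \<Xi>" for \<xi>
  proof -
    interpret prob_space "law (\<pi> \<xi>) n" by (rule L(1)[OF \<pi>[OF that]])
    have "(\<integral>z. 1 + t * \<psi> z \<partial>law (\<pi> \<xi>) n) = 1 + t * E (\<pi> \<xi>)"
      using \<psi>_int[OF \<pi>[OF that]] by (simp add: E_def prob_space)
    then show ?thesis using E0[OF \<pi>[OF that]] t by (simp add: ln_add_one_self_le_self)
  qed
  have "(\<Sum>\<xi>\<in>\<Xi>. \<integral>z. ln (1 + t * \<psi> z) \<partial>law p0 n)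
      \<le> real n * ?k + (\<Sum>\<xi>\<in>\<Xi>. ln (\<integral>z. 1 + t * \<psi> z \<partial>law (\<pi> \<xi>) n))"
  proof (rule information_bound[OF \<alpha> p0 \<pi> S order.refl])
    show "1 \<le> 1 + t * \<psi> z \<and> 1 + t * \<psi> z \<le> 1 + t" if "z \<in> space (history n)" for z
      using \<psi>b[OF that] t by (simp add: mult_left_le)
    show "(\<lambda>z. 1 + t * \<psi> z) \<in> borel_measurable (history n)" by measurable
  qed
  also have "\<dots> \<le> real n * ?k + (\<Sum>\<xi>\<in>\<Xi>. t * E (\<pi> \<xi>))"
    by (intro add_left_mono sum_mono upper)
  finally have "card \<Xi> * (t * E p0 - t\<^sup>2) \<le> real n * ?k + t * (\<Sum>\<xi>\<in>\<Xi>. E (\<pi> \<xi>))"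
    using mult_left_mono[OF lower, of "card \<Xi>"] by (simp add: sum_distrib_left)
  then have "(card \<Xi> * (t * E p0 - t\<^sup>2)) / t \<le> (real n * ?k + t * (\<Sum>\<xi>\<in>\<Xi>. E (\<pi> \<xi>))) / t"
    using t by (intro divide_right_mono) auto
  moreover have "(card \<Xi> * (t * E p0 - t\<^sup>2)) / t = card \<Xi> * (E p0 - t)"
    using t by (simp add: field_simps power2_eq_square)
  moreover have "(real n * ?k + t * (\<Sum>\<xi>\<in>\<Xi>. E (\<pi> \<xi>))) / t
      = card \<Xi> * (12 * n * \<alpha>\<^sup>2 * S / t) + (\<Sum>\<xi>\<in>\<Xi>. E (\<pi> \<xi>))"
    using t by (simp add: add_divide_distrib)
  ultimately have "card \<Xi> * (E p0 - t) \<le> card \<Xi> * (12 * n * \<alpha>\<^sup>2 * S / t) + (\<Sum>\<xi>\<in>\<Xi>. E (\<pi> \<xi>))"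
    by simp
  then have "card \<Xi> * (1 - 12 * n * \<alpha>\<^sup>2 * S / t - t) \<le> card \<Xi> * (1 - E p0) + (\<Sum>\<xi>\<in>\<Xi>. E (\<pi> \<xi>))"
    by (simp add: algebra_simps)
  then show ?thesis
    by (simp add: \<phi>_E sum.distrib) (simp add: expect_def E_def \<psi>_def)
qed

end

subsection \<open>Reduction to finitely many alternatives\<close>

text \<open>Whatever the mechanism and the test, the worst alternative is at least as bad as the
  average over \<open>\<Xi>\<close>.\<close>

lemma ldp_risk_gt:
  fixes \<pi> :: "'x \<Rightarrow> nat \<Rightarrow> real" and S :: real
  assumes \<gamma>: "0 < \<gamma>" "\<gamma> < 1" and \<alpha>: "0 < \<alpha>" "\<alpha> \<le> 1" and p0: "p0 \<in> prob_simplex d"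
    and \<Xi>: "finite \<Xi>" "\<Xi> \<noteq> {}" and \<pi>: "\<And>\<xi>. \<xi> \<in> \<Xi> \<Longrightarrow> \<pi> \<xi> \<in> H1 d p0 \<delta> r"
    and S: "\<And>g. (\<And>x. \<bar>g x\<bar> \<le> 1) \<Longrightarrow>
              (\<Sum>\<xi>\<in>\<Xi>. (\<Sum>x=1..d. (\<pi> \<xi> x - p0 x) * g x)\<^sup>2) \<le> S * card \<Xi>"
    and small: "n * \<alpha>\<^sup>2 * S \<le> (1 - \<gamma>)\<^sup>2 / 192"
  shows "ereal \<gamma> < ldp_risk TYPE('z) n \<alpha> d p0 \<delta> r"
proof -
  \<comment> \<open>With the 192 = 12 * 16 of \<open>small\<close>, this choice makes both error
    terms at most \<open>(1 - \<gamma>) / 4\<close>, which leaves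
    \<open>(1 + \<gamma>) / 2\<close>.\<close>
  define t where "t = (1 - \<gamma>) / 4"
  have t: "0 < t" "t \<le> 1" using \<gamma> by (auto simp: t_def)
  have "12 * n * \<alpha>\<^sup>2 * S / t \<le> 12 * ((1 - \<gamma>)\<^sup>2 / 192) / t"
    using small t by (intro divide_right_mono) auto
  also have "\<dots> = t" using \<gamma> by (simp add: t_def field_simps power2_eq_square)
  finally have bound: "(1 + \<gamma>) / 2 \<le> 1 - 12 * n * \<alpha>\<^sup>2 * S / t - t"
    using \<gamma> by (simp add: t_def field_simps)
  \<comment> \<open>An infimum preserves only weak inequalities, so the bound is shown for the
    midpoint between \<open>\<gamma>\<close> and 1 to obtain strictness at the end.\<close>
  have "ereal ((1 + \<gamma>) / 2) \<le> ldp_risk TYPE('z) n \<alpha> d p0 \<delta> r"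
    unfolding ldp_risk_def risk_def
  proof (intro INF_greatest)
    fix M :: "'z mechanism" and \<phi>
    assume M: "M \<in> ldp_mechanisms \<alpha> n d" and \<phi>: "\<phi> \<in> tests M n"
    obtain Z Q where ZQ: "M = (Z, Q)" by (cases M)
    interpret ldp_mechanism Z Q \<alpha> n d by unfold_locales (use M ZQ in simp)
    let ?R = "\<lambda>p. expect M n d p0 \<phi> + expect M n d p (\<lambda>z. 1 - \<phi> z)"
    have "card \<Xi> * ((1 + \<gamma>) / 2) \<le> card \<Xi> * (1 - 12 * n * \<alpha>\<^sup>2 * S / t - t)"
      using bound by (intro mult_left_mono) auto
    also have "\<dots> \<le> (\<Sum>\<xi>\<in>\<Xi>. ?R (\<pi> \<xi>))"
      unfolding ZQ using \<pi> \<phi> by (intro average_risk_lower_bound[OF \<alpha> p0 _ S _ t]) (auto simp: H1_def ZQ)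
    finally have avg: "(\<Sum>\<xi>\<in>\<Xi>. (1 + \<gamma>) / 2) \<le> (\<Sum>\<xi>\<in>\<Xi>. ?R (\<pi> \<xi>))" by simp
    obtain \<xi> where \<xi>: "\<xi> \<in> \<Xi>" "(1 + \<gamma>) / 2 \<le> ?R (\<pi> \<xi>)"
    proof (rule ccontr)
      assume "\<not> thesis"
      then have "\<And>\<xi>. \<xi> \<in> \<Xi> \<Longrightarrow> ?R (\<pi> \<xi>) < (1 + \<gamma>) / 2" using that by force
      then have "(\<Sum>\<xi>\<in>\<Xi>. ?R (\<pi> \<xi>)) < (\<Sum>\<xi>\<in>\<Xi>. (1 + \<gamma>) / 2)"
        using \<Xi> by (intro sum_strict_mono) auto
      with avg show False by linarith
    qed
    then have "ereal ((1 + \<gamma>) / 2) \<le> ereal (?R (\<pi> \<xi>))" by simp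
    also have "\<dots> \<le> (SUP p\<in>H1 d p0 \<delta> r. ereal (?R p))"
      by (rule SUP_upper[OF \<pi>[OF \<xi>(1)]])
    finally show "ereal ((1 + \<gamma>) / 2) \<le> (SUP p\<in>H1 d p0 \<delta> r. ereal (?R p))" .
  qed
  moreover have "ereal \<gamma> < ereal ((1 + \<gamma>) / 2)" using \<gamma> by simp
  ultimately show ?thesis by (rule less_le_trans[rotated])
qed

text \<open>Only levels \<open>\<delta>\<close> with a nonempty alternative compete for the infimum,
  so nonemptiness is at hand as a premise; it provides the endpoint of the segments on which single
  alternatives are placed.\<close>

lemma critical_radius_ge:
  assumes "\<And>\<delta>. 0 < \<delta> \<Longrightarrow> \<delta> < c \<Longrightarrow> H1 d p0 \<delta> r \<noteq> {} \<Longrightarrow> ereal \<gamma> < ldp_risk Z n \<alpha> d p0 \<delta> r"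
  shows "ereal c \<le> critical_radius Z \<gamma> n \<alpha> d p0 r"
  unfolding critical_radius_def
proof (rule Inf_greatest)
  fix x assume "x \<in> {ereal \<delta> | \<delta>. 0 < \<delta> \<and> H1 d p0 \<delta> r \<noteq> {} \<and> ldp_risk Z n \<alpha> d p0 \<delta> r \<le> ereal \<gamma>}"
  then obtain \<delta> where "x = ereal \<delta>" "0 < \<delta>" "H1 d p0 \<delta> r \<noteq> {}" "\<not> ereal \<gamma> < ldp_risk Z n \<alpha> d p0 \<delta> r"
    by (auto simp: not_less)
  then show "ereal c \<le> x" using assms[of \<delta>] by (cases "\<delta> < c") auto
qed

text \<open>For one alternative, duality of the l1 and sup norms gives
  \<open>S = L\<^sup>2\<close>.\<close>

lemma ldp_risk_gt_single:
  assumes \<gamma>: "0 < \<gamma>" "\<gamma> < 1" and \<alpha>: "0 < \<alpha>" "\<alpha> \<le> 1" and p0: "p0 \<in> prob_simplex d"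
    and p: "p \<in> H1 d p0 \<delta> r" and L: "(\<Sum>x=1..d. \<bar>p x - p0 x\<bar>) \<le> L"
    and small: "n * \<alpha>\<^sup>2 * L\<^sup>2 \<le> (1 - \<gamma>)\<^sup>2 / 192"
  shows "ereal \<gamma> < ldp_risk TYPE('z) n \<alpha> d p0 \<delta> r"
proof (rule ldp_risk_gt[OF \<gamma> \<alpha> p0, of "{()}" "\<lambda>_. p"])
  fix g :: "nat \<Rightarrow> real" assume g: "\<And>x. \<bar>g x\<bar> \<le> 1"
  have "\<bar>\<Sum>x=1..d. (p x - p0 x) * g x\<bar> \<le> (\<Sum>x=1..d. \<bar>p x - p0 x\<bar>)"
    using g by (intro order_trans[OF sum_abs] sum_mono) (auto simp: abs_mult mult_left_le)
  then have "\<bar>\<Sum>x=1..d. (p x - p0 x) * g x\<bar> \<le> L" using L by linarith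
  from power_mono[OF this, of 2]
  show "(\<Sum>\<xi>\<in>{()}. (\<Sum>x=1..d. (p x - p0 x) * g x)\<^sup>2) \<le> L\<^sup>2 * card {()}" by simp
qed (use p small in auto)

lemma prob_simplexI:
  assumes "p \<in> extensional {1..d}" "\<And>x. x \<in> {1..d} \<Longrightarrow> 0 \<le> p x" "(\<Sum>x=1..d. p x) = 1"
  shows "p \<in> prob_simplex d"
proof -
  have "p x \<le> 1" if "x \<in> {1..d}" for x
    using member_le_sum[OF that, of p] assms by auto
  then show ?thesis using assms by (auto simp: prob_simplex_def PiE_def)
qed

text \<open>Moving from \<open>p\<^sub>0\<close> towards \<open>p\<close> until the distance is exactly \<open>\<delta>\<close>.\<close>

lemma H1_segment_point:
  assumes r: "0 < r" and p0: "p0 \<in> prob_simplex d" and p: "p \<in> H1 d p0 \<delta> r" and \<delta>: "0 < \<delta>"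
  obtains p' where "p' \<in> H1 d p0 \<delta> r"
    "(\<Sum>x=1..d. \<bar>p' x - p0 x\<bar>) = \<delta> / lr_dist r d p p0 * (\<Sum>x=1..d. \<bar>p x - p0 x\<bar>)"
proof -
  define s where "s = \<delta> / lr_dist r d p p0"
  define p' where "p' = restrict (\<lambda>x. p0 x + s * (p x - p0 x)) {1..d}"
  have D: "\<delta> \<le> lr_dist r d p p0" and p_simp: "p \<in> prob_simplex d" using p by (auto simp: H1_def)
  have s: "0 < s" "s \<le> 1" using D \<delta> by (auto simp: s_def)
  have p': "p' x = (1 - s) * p0 x + s * p x" "p' x - p0 x = s * (p x - p0 x)" if "x \<in> {1..d}" for x
    using that by (auto simp: p'_def algebra_simps)
  have "p' \<in> prob_simplex d"
  proof (rule prob_simplexI)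
    show "p' \<in> extensional {1..d}" by (simp add: p'_def)
    show "0 \<le> p' x" if "x \<in> {1..d}" for x
      using prob_simplexD(2)[OF p0 that] prob_simplexD(2)[OF p_simp that] s by (simp only: p'[OF that]) simp
    have "(\<Sum>x=1..d. p' x) = (1 - s) * (\<Sum>x=1..d. p0 x) + s * (\<Sum>x=1..d. p x)"
      unfolding sum_distrib_left sum.distrib[symmetric] by (intro sum.cong refl p')
    then show "(\<Sum>x=1..d. p' x) = 1" using prob_simplexD(1)[OF p0] prob_simplexD(1)[OF p_simp] by simp
  qed
  moreover have "lr_dist r d p' p0 = \<delta>"
  proof -
    have "(\<Sum>x=1..d. \<bar>p' x - p0 x\<bar> ^ r) = s ^ r * (\<Sum>x=1..d. \<bar>p x - p0 x\<bar> ^ r)"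
      unfolding sum_distrib_left using s by (intro sum.cong refl) (simp add: p'(2) abs_mult power_mult_distrib)
    then have "lr_dist r d p' p0 = s * lr_dist r d p p0"
      using r s by (simp add: lr_dist_def real_root_mult real_root_power_cancel)
    then show ?thesis using D \<delta> by (simp add: s_def)
  qed
  ultimately have "p' \<in> H1 d p0 \<delta> r" by (simp add: H1_def)
  moreover have "(\<Sum>x=1..d. \<bar>p' x - p0 x\<bar>) = s * (\<Sum>x=1..d. \<bar>p x - p0 x\<bar>)"
    unfolding sum_distrib_left using s by (intro sum.cong refl) (simp add: p'(2) abs_mult)
  ultimately show thesis using that by (simp add: s_def)
qed

text \<open>The point at distance exactly \<open>\<delta>\<close> on a segment from
  \<open>p0\<close> has \<open>S = \<delta>\<^sup>2\<close>. This covers the case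
  \<open>j = 1\<close>, in which \<open>j div 2\<close> leaves no pair of cells.\<close>

lemma ldp_risk_gt_L1:
  assumes \<gamma>: "0 < \<gamma>" "\<gamma> < 1" and \<alpha>: "0 < \<alpha>" "\<alpha> \<le> 1" and p0: "p0 \<in> prob_simplex d"
    and \<delta>: "0 < \<delta>" and H1: "H1 d p0 \<delta> 1 \<noteq> {}"
    and small: "n * \<alpha>\<^sup>2 * \<delta>\<^sup>2 \<le> (1 - \<gamma>)\<^sup>2 / 192"
  shows "ereal \<gamma> < ldp_risk TYPE('z) n \<alpha> d p0 \<delta> 1"
proof -
  obtain p where p: "p \<in> H1 d p0 \<delta> 1" using H1 by blast
  obtain p' where p': "p' \<in> H1 d p0 \<delta> 1"
    "(\<Sum>x=1..d. \<bar>p' x - p0 x\<bar>) = \<delta> / lr_dist 1 d p p0 * (\<Sum>x=1..d. \<bar>p x - p0 x\<bar>)"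
    using H1_segment_point[OF _ p0 p \<delta>] by auto
  have "lr_dist 1 d p p0 = (\<Sum>x=1..d. \<bar>p x - p0 x\<bar>)" "0 < lr_dist 1 d p p0"
    using p \<delta> by (auto simp: lr_dist_def H1_def)
  then have "(\<Sum>x=1..d. \<bar>p' x - p0 x\<bar>) \<le> \<delta>" using p'(2) by simp
  from ldp_risk_gt_single[OF \<gamma> \<alpha> p0 p'(1) this small] show ?thesis .
qed

text \<open>By convexity, some vertex of the simplex is at least as far from \<open>p\<^sub>0\<close> as \<open>p\<close> is; along the
  edge towards a vertex the two norms are comparable.\<close>

lemma H1_L2_vertex:
  assumes p0: "p0 \<in> prob_simplex d" and p: "p \<in> H1 d p0 \<delta> 2"
  obtains e where "e \<in> H1 d p0 \<delta> 2" "(\<Sum>x=1..d. \<bar>e x - p0 x\<bar>) \<le> 2 * lr_dist 2 d e p0"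
proof -
  have ps: "p \<in> prob_simplex d" and D: "\<delta> \<le> lr_dist 2 d p p0" using p by (auto simp: H1_def)
  note p0D = prob_simplexD[OF p0] and pD = prob_simplexD[OF ps]
  define e where "e k = restrict (\<lambda>x. if x = k then 1 else 0 :: real) {1..d}" for k
  have e: "e k x = (if x = k then 1 else 0)" if "x \<in> {1..d}" for k x using that by (simp add: e_def)
  have e_simp: "e k \<in> prob_simplex d" if "k \<in> {1..d}" for k
    by (rule prob_simplexI) (use that in \<open>auto simp: e_def\<close>)
  define N2 where "N2 q = (\<Sum>x=1..d. (q x - p0 x)\<^sup>2)" for q
  have N2e: "N2 (e k) = 1 - 2 * p0 k + (\<Sum>x=1..d. (p0 x)\<^sup>2)" if k: "k \<in> {1..d}" for k
  proof -
    have "N2 (e k) = (\<Sum>x=1..d. (if x = k then 1 - 2 * p0 k else 0) + (p0 x)\<^sup>2)"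
      unfolding N2_def by (intro sum.cong refl) (auto simp: e power2_eq_square algebra_simps)
    then show ?thesis using k by (simp add: sum.distrib)
  qed
  have "N2 p = (\<Sum>x=1..d. (p x)\<^sup>2) - 2 * (\<Sum>x=1..d. p x * p0 x) + (\<Sum>x=1..d. (p0 x)\<^sup>2)"
    by (simp add: N2_def power2_diff sum.distrib sum_subtractf sum_distrib_left mult.assoc)
  \<comment> \<open>The bound on \<open>N2 p\<close> that this produces is the mean of
    \<open>N2 (e k)\<close> under the weights \<open>p k\<close>, so some vertex is at least as far
    away as \<open>p\<close>.\<close>
  also have "(\<Sum>x=1..d. (p x)\<^sup>2) \<le> (\<Sum>x=1..d. p x)"
  proof (rule sum_mono)
    fix x assume x: "x \<in> {1..d}"
    have "p x \<le> 1" using member_le_sum[OF x, of p] pD by auto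
    then show "(p x)\<^sup>2 \<le> p x" using pD(2)[OF x] by (simp add: power2_eq_square mult_left_le)
  qed
  finally have N2p: "N2 p \<le> 1 - 2 * (\<Sum>x=1..d. p x * p0 x) + (\<Sum>x=1..d. (p0 x)\<^sup>2)" using pD(1) by simp
  obtain k where k: "k \<in> {1..d}" "N2 p \<le> N2 (e k)"
  proof (rule ccontr)
    assume "\<not> thesis"
    then have less: "\<And>k. k \<in> {1..d} \<Longrightarrow> N2 (e k) < N2 p" using that by force
    \<comment> \<open>A cell of positive weight makes the averaged inequality strict.\<close>
    obtain k0 where k0: "k0 \<in> {1..d}" "0 < p k0"
    proof (rule ccontr)
      assume "\<not> thesis"
      then have "(\<Sum>x=1..d. p x) \<le> (\<Sum>x=1..d. 0)" using that by (intro sum_mono) force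
      then show False using pD(1) by simp
    qed
    have "(\<Sum>k=1..d. p k * N2 (e k)) < (\<Sum>k=1..d. p k * N2 p)"
    proof (rule sum_strict_mono_ex1)
      show "\<forall>x\<in>{1..d}. p x * N2 (e x) \<le> p x * N2 p"
        using less_imp_le[OF less] pD(2) by (intro ballI mult_left_mono)
      show "\<exists>a\<in>{1..d}. p a * N2 (e a) < p a * N2 p" using k0 less by (intro bexI[of _ k0]) auto
    qed simp
    also have "\<dots> = N2 p" using pD(1) by (simp add: sum_distrib_right[symmetric])
    also have "(\<Sum>k=1..d. p k * N2 (e k)) = (\<Sum>k=1..d. p k * (1 + (\<Sum>x=1..d. (p0 x)\<^sup>2)) - 2 * (p k * p0 k))"
      by (intro sum.cong refl) (simp add: N2e algebra_simps)
    also have "\<dots> = 1 + (\<Sum>x=1..d. (p0 x)\<^sup>2) - 2 * (\<Sum>x=1..d. p x * p0 x)"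
      using pD(1) by (simp add: sum_subtractf sum_distrib_right[symmetric] sum_distrib_left[symmetric])
    finally show False using N2p by simp
  qed
  have lr2: "lr_dist 2 d q p0 = sqrt (N2 q)" for q
    by (simp add: lr_dist_def N2_def sqrt_def)
  have "\<delta> \<le> lr_dist 2 d (e k) p0" using D k(2) unfolding lr2 by (meson order_trans real_sqrt_le_mono)
  then have "e k \<in> H1 d p0 \<delta> 2" using e_simp[OF k(1)] by (simp add: H1_def)
  moreover have "(\<Sum>x=1..d. \<bar>e k x - p0 x\<bar>) \<le> 2 * lr_dist 2 d (e k) p0"
  proof -
    have p0k: "p0 k \<le> 1" using member_le_sum[OF k(1), of p0] p0D by auto
    \<comment> \<open>Moving to the vertex adds \<open>1 - p0 k\<close> to cell \<open>k\<close> and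
      removes the same total elsewhere, hence the factor 2; cell \<open>k\<close> alone already
      makes the l2 distance at least \<open>1 - p0 k\<close>.\<close>
    have "(\<Sum>x=1..d. \<bar>e k x - p0 x\<bar>) = (\<Sum>x=1..d. (if x = k then 1 - 2 * p0 k else 0) + p0 x)"
      using p0D(2) p0k by (intro sum.cong refl) (auto simp: e)
    also have "\<dots> = 2 * (1 - p0 k)" using k(1) p0D(1) by (simp add: sum.distrib)
    also have "1 - p0 k \<le> sqrt (N2 (e k))"
    proof (rule real_le_rsqrt)
      have "(e k k - p0 k)\<^sup>2 \<le> N2 (e k)" unfolding N2_def by (rule member_le_sum[OF k(1)]) auto
      then show "(1 - p0 k)\<^sup>2 \<le> N2 (e k)" using k(1) by (simp add: e)
    qed
    finally show ?thesis by (simp add: lr2)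
  qed
  ultimately show thesis by (rule that)
qed

text \<open>The alternative lies on the segment towards a vertex, where the l1 distance is at most
  twice the l2 distance. In a general direction their ratio can grow like the square root of
  \<open>d\<close>, which a constant free of the dimension cannot absorb.\<close>

lemma ldp_risk_gt_L2:
  assumes \<gamma>: "0 < \<gamma>" "\<gamma> < 1" and \<alpha>: "0 < \<alpha>" "\<alpha> \<le> 1" and p0: "p0 \<in> prob_simplex d"
    and \<delta>: "0 < \<delta>" and H1: "H1 d p0 \<delta> 2 \<noteq> {}"
    and small: "n * \<alpha>\<^sup>2 * (2 * \<delta>)\<^sup>2 \<le> (1 - \<gamma>)\<^sup>2 / 192"
  shows "ereal \<gamma> < ldp_risk TYPE('z) n \<alpha> d p0 \<delta> 2"
proof -
  obtain p where p: "p \<in> H1 d p0 \<delta> 2" using H1 by blast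
  obtain e where e: "e \<in> H1 d p0 \<delta> 2" "(\<Sum>x=1..d. \<bar>e x - p0 x\<bar>) \<le> 2 * lr_dist 2 d e p0"
    using H1_L2_vertex[OF p0 p] .
  obtain p' where p': "p' \<in> H1 d p0 \<delta> 2"
    "(\<Sum>x=1..d. \<bar>p' x - p0 x\<bar>) = \<delta> / lr_dist 2 d e p0 * (\<Sum>x=1..d. \<bar>e x - p0 x\<bar>)"
    using H1_segment_point[OF _ p0 e(1) \<delta>] by auto
  have D: "0 < lr_dist 2 d e p0" using e(1) \<delta> by (simp add: H1_def)
  then have "(\<Sum>x=1..d. \<bar>p' x - p0 x\<bar>) \<le> \<delta> / lr_dist 2 d e p0 * (2 * lr_dist 2 d e p0)"
    unfolding p'(2) using \<delta> e(2) by (intro mult_left_mono) auto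
  then have "(\<Sum>x=1..d. \<bar>p' x - p0 x\<bar>) \<le> 2 * \<delta>" using D by simp
  from ldp_risk_gt_single[OF \<gamma> \<alpha> p0 p'(1) this small] show ?thesis .
qed

subsection \<open>The lower bounds\<close>

text \<open>A vector of signs is encoded by its set of plus signs, so that the uniform prior ranges
  over a powerset and induction on the index set applies.\<close>

definition subset_sign :: "nat set \<Rightarrow> nat \<Rightarrow> real" where
  "subset_sign A a = (if a \<in> A then 1 else - 1)"

text \<open>Independent symmetric signs are uncorrelated, so cross terms cancel. A new index
  \<open>b\<close> pairs each subset \<open>A\<close> of \<open>I\<close> with
  \<open>insert b A\<close>, and \<open>(T - c)\<^sup>2 + (T + c)\<^sup>2 = 2 * T\<^sup>2 + 2 *
  c\<^sup>2\<close>.\<close>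

lemma sum_Pow_signed_sum_square:
  fixes c :: "nat \<Rightarrow> real"
  assumes "finite I"
  shows "(\<Sum>A\<in>Pow I. (\<Sum>a\<in>I. subset_sign A a * c a)\<^sup>2) = card (Pow I) * (\<Sum>a\<in>I. (c a)\<^sup>2)"
  using assms
proof induction
  case empty
  show ?case by simp
next
  case (insert b I)
  let ?T = "\<lambda>A. \<Sum>a\<in>I. subset_sign A a * c a"
  have minus: "(\<Sum>a\<in>insert b I. subset_sign A a * c a) = ?T A - c b" if "A \<in> Pow I" for A
    using insert.hyps that by (auto simp: subset_sign_def)
  have plus: "(\<Sum>a\<in>insert b I. subset_sign (insert b A) a * c a) = ?T A + c b" for A
  proof -
    have "(\<Sum>a\<in>I. subset_sign (insert b A) a * c a) = ?T A"
      using insert.hyps by (intro sum.cong refl) (auto simp: subset_sign_def)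
    then show ?thesis using insert.hyps by (simp add: subset_sign_def)
  qed
  have inj: "inj_on (insert b) (Pow I)" using insert.hyps by (auto simp: inj_on_def)
  have disj: "Pow I \<inter> insert b ` Pow I = {}" using insert.hyps by auto
  have "(\<Sum>A\<in>Pow (insert b I). (\<Sum>a\<in>insert b I. subset_sign A a * c a)\<^sup>2)
      = (\<Sum>A\<in>Pow I. (?T A - c b)\<^sup>2) + (\<Sum>A\<in>Pow I. (?T A + c b)\<^sup>2)"
    unfolding Pow_insert
    using insert.hyps disj inj
    by (subst sum.union_disjoint) (auto simp: sum.reindex minus plus simp del: sum.insert)
  also have "\<dots> = (\<Sum>A\<in>Pow I. 2 * (?T A)\<^sup>2 + 2 * (c b)\<^sup>2)"
    unfolding sum.distrib[symmetric] by (intro sum.cong refl) (simp add: power2_eq_square algebra_simps)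
  also have "\<dots> = 2 * (card (Pow I) * (\<Sum>a\<in>I. (c a)\<^sup>2)) + 2 * (card (Pow I) * (c b)\<^sup>2)"
    by (simp only: sum.distrib sum_distrib_left[symmetric] insert.IH) simp
  also have "\<dots> = card (Pow (insert b I)) * (\<Sum>a\<in>insert b I. (c a)\<^sup>2)"
    using insert.hyps by (simp add: card_Pow algebra_simps)
  finally show ?case .
qed

lemma sum_pairs:
  fixes F :: "nat \<Rightarrow> real"
  shows "(\<Sum>x=1..2 * m. F x) = (\<Sum>a=1..m. F (2 * a - 1) + F (2 * a))"
  by (induction m) auto

text \<open>The prior is uniform over the sign vectors, encoded as subsets of \<open>{1..m}\<close>. Each sign moves
  mass \<open>\<delta> / (2 * m)\<close> between the cells \<open>2 * a - 1\<close> and \<open>2 * a\<close>.\<close>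

lemma ldp_risk_gt_pairs:
  assumes \<gamma>: "0 < \<gamma>" "\<gamma> < 1" and \<alpha>: "0 < \<alpha>" "\<alpha> \<le> 1" and p0: "p0 \<in> prob_simplex d"
    and \<delta>: "0 < \<delta>" and m: "1 \<le> m" "2 * m \<le> d"
    and mass: "\<And>x. x \<in> {1..2 * m} \<Longrightarrow> \<delta> / (2 * m) \<le> p0 x"
    and small: "n * \<alpha>\<^sup>2 * (\<delta>\<^sup>2 / m) \<le> (1 - \<gamma>)\<^sup>2 / 192"
  shows "ereal \<gamma> < ldp_risk TYPE('z) n \<alpha> d p0 \<delta> 1"
proof -
  define \<epsilon> where "\<epsilon> = \<delta> / (2 * m)"
  have \<epsilon>: "0 < \<epsilon>" using \<delta> m by (simp add: \<epsilon>_def)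
  \<comment> \<open>\<open>(x + 1) div 2\<close> is the index of the pair containing cell
    \<open>x\<close>. The odd cell of a pair gets the sign and the even cell its opposite, so total
    mass is preserved.\<close>
  define w where "w A x = (if x \<le> 2 * m then \<epsilon> * subset_sign A ((x + 1) div 2) * (if odd x then 1 else - 1) else 0)"
    for A x
  define \<pi> where "\<pi> A = restrict (\<lambda>x. p0 x + w A x) {1..d}" for A
  have w_sum: "(\<Sum>x=1..d. w A x * g x) = (\<Sum>a=1..m. subset_sign A a * (\<epsilon> * (g (2 * a - 1) - g (2 * a))))" for A g
  proof -
    have "(\<Sum>x=1..d. w A x * g x) = (\<Sum>x=1..2 * m. w A x * g x)"
      using m by (intro sum.mono_neutral_right) (auto simp: w_def)
    also have "\<dots> = (\<Sum>a=1..m. w A (2 * a - 1) * g (2 * a - 1) + w A (2 * a) * g (2 * a))"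
      by (rule sum_pairs)
    also have "\<dots> = (\<Sum>a=1..m. subset_sign A a * (\<epsilon> * (g (2 * a - 1) - g (2 * a))))"
    proof (intro sum.cong refl)
      fix a assume a: "a \<in> {1..m}"
      have "w A (2 * a - 1) = \<epsilon> * subset_sign A a" "w A (2 * a) = - (\<epsilon> * subset_sign A a)"
        using a by (auto simp: w_def)
      then show "w A (2 * a - 1) * g (2 * a - 1) + w A (2 * a) * g (2 * a)
          = subset_sign A a * (\<epsilon> * (g (2 * a - 1) - g (2 * a)))"
        by (simp add: algebra_simps)
    qed
    finally show ?thesis .
  qed
  have w_abs: "\<bar>w A x\<bar> = (if x \<le> 2 * m then \<epsilon> else 0)" for A x
    using \<epsilon> by (auto simp: w_def subset_sign_def)
  have \<pi>_diff: "\<pi> A x - p0 x = w A x" if "x \<in> {1..d}" for A x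
    using that by (simp add: \<pi>_def)
  show ?thesis
  proof (rule ldp_risk_gt[OF \<gamma> \<alpha> p0, of "Pow {1..m}" \<pi>])
    fix A assume "A \<in> Pow {1..m}"
    have "\<pi> A \<in> prob_simplex d"
    proof (rule prob_simplexI)
      show "\<pi> A \<in> extensional {1..d}" by (simp add: \<pi>_def)
      show "0 \<le> \<pi> A x" if "x \<in> {1..d}" for x
        using \<pi>_diff[OF that, of A] w_abs[of A x] mass[of x] prob_simplexD(2)[OF p0 that] that
        by (auto simp: \<epsilon>_def split: if_splits)
      have "(\<Sum>x=1..d. \<pi> A x) = (\<Sum>x=1..d. p0 x) + (\<Sum>x=1..d. w A x * 1)"
        unfolding sum.distrib[symmetric] by (intro sum.cong refl) (simp add: \<pi>_def)
      then show "(\<Sum>x=1..d. \<pi> A x) = 1"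
        unfolding w_sum using prob_simplexD(1)[OF p0] by simp
    qed
    moreover have "lr_dist 1 d (\<pi> A) p0 = \<delta>"
    proof -
      have "lr_dist 1 d (\<pi> A) p0 = (\<Sum>x=1..d. if x \<le> 2 * m then \<epsilon> else 0)"
        by (simp add: lr_dist_def \<pi>_diff w_abs cong: sum.cong_simp)
      also have "\<dots> = (\<Sum>x=1..2 * m. \<epsilon>)"
        using m by (intro sum.mono_neutral_cong_right) auto
      finally show ?thesis using m by (simp add: \<epsilon>_def)
    qed
    ultimately show "\<pi> A \<in> H1 d p0 \<delta> 1" by (simp add: H1_def)
  next
    fix g :: "nat \<Rightarrow> real" assume g: "\<And>x. \<bar>g x\<bar> \<le> 1"
    have "(\<Sum>A\<in>Pow {1..m}. (\<Sum>x=1..d. (\<pi> A x - p0 x) * g x)\<^sup>2)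
        = (\<Sum>A\<in>Pow {1..m}. (\<Sum>a=1..m. subset_sign A a * (\<epsilon> * (g (2 * a - 1) - g (2 * a))))\<^sup>2)"
      unfolding w_sum[symmetric] by (intro sum.cong refl arg_cong[where f="\<lambda>t. t\<^sup>2"]) (simp add: \<pi>_diff)
    also have "\<dots> = card (Pow {1..m}) * (\<Sum>a=1..m. (\<epsilon> * (g (2 * a - 1) - g (2 * a)))\<^sup>2)"
      by (rule sum_Pow_signed_sum_square) simp
    \<comment> \<open>Each pair contributes at most \<open>(2 * \<epsilon>)\<^sup>2\<close>, and
      \<open>m\<close> of them add up to \<open>\<delta>\<^sup>2 / m\<close>. The gain of a factor
      \<open>m\<close> over the bound for a single alternative at the same distance is the source of
      \<open>sqrt j\<close> in the rate.\<close>
    also have "\<dots> \<le> card (Pow {1..m}) * (\<Sum>a=1..m. (2 * \<epsilon>)\<^sup>2)"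
    proof (intro mult_left_mono sum_mono)
      fix a
      have "\<bar>g (2 * a - 1) - g (2 * a)\<bar> \<le> 2" using g[of "2 * a - 1"] g[of "2 * a"] by linarith
      then have "\<bar>\<epsilon> * (g (2 * a - 1) - g (2 * a))\<bar> \<le> 2 * \<epsilon>"
        using \<epsilon> by (simp add: abs_mult mult.commute)
      from power_mono[OF this, of 2]
      show "(\<epsilon> * (g (2 * a - 1) - g (2 * a)))\<^sup>2 \<le> (2 * \<epsilon>)\<^sup>2" by simp
    qed auto
    also have "(\<Sum>a=1..m. (2 * \<epsilon>)\<^sup>2) = \<delta>\<^sup>2 / m"
      using m by (simp add: \<epsilon>_def field_simps power2_eq_square)
    finally show "(\<Sum>A\<in>Pow {1..m}. (\<Sum>x=1..d. (\<pi> A x - p0 x) * g x)\<^sup>2) \<le> \<delta>\<^sup>2 / m * card (Pow {1..m})"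
      by (simp add: mult.commute)
  qed (use small in auto)
qed

section \<open>Critical radii in the two norms\<close>

lemma critical_radius_L2:
  assumes \<gamma>: "0 < \<gamma>" "\<gamma> < 1" and n: "1 \<le> n" and \<alpha>: "0 < \<alpha>" "\<alpha> \<le> 1" and p0: "p0 \<in> prob_simplex d"
  shows "ereal ((1 - \<gamma>) / 30 * (1 / sqrt (real n * \<alpha>\<^sup>2))) \<le> critical_radius TYPE('z) \<gamma> n \<alpha> d p0 2"
proof (rule critical_radius_ge, rule ldp_risk_gt_L2[OF \<gamma> \<alpha> p0])
  fix \<delta> :: real
  assume \<delta>: "0 < \<delta>" "\<delta> < (1 - \<gamma>) / 30 * (1 / sqrt (real n * \<alpha>\<^sup>2))"
  define N where "N = real n * \<alpha>\<^sup>2"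
  have N: "0 < N" using n \<alpha> by (simp add: N_def)
  have "\<delta> * sqrt N \<le> (1 - \<gamma>) / 30" using \<delta> N by (simp add: N_def[symmetric] field_simps)
  then have "(\<delta> * sqrt N)\<^sup>2 \<le> ((1 - \<gamma>) / 30)\<^sup>2" using \<delta> N by (intro power_mono) auto
  then have "N * (2 * \<delta>)\<^sup>2 \<le> 4 * ((1 - \<gamma>) / 30)\<^sup>2" using N by (simp add: power_mult_distrib mult.commute)
  \<comment> \<open>The divisor 30 is large enough for \<open>4 / 900 \<le> 1 / 192\<close>.\<close>
  also have "\<dots> \<le> (1 - \<gamma>)\<^sup>2 / 192" by (simp add: power_divide)
  finally show "real n * \<alpha>\<^sup>2 * (2 * \<delta>)\<^sup>2 \<le> (1 - \<gamma>)\<^sup>2 / 192" by (simp add: N_def)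
qed

text \<open>For \<open>j \<ge> 2\<close> the first \<open>2 * (j div 2)\<close> cells are perturbed;
  as \<open>p0\<close> is nonincreasing, each holds mass at least \<open>p0 j\<close>, which leaves
  room for the perturbation.\<close>

lemma critical_radius_L1:
  assumes \<gamma>: "0 < \<gamma>" "\<gamma> < 1" and n: "1 \<le> n" and \<alpha>: "0 < \<alpha>" "\<alpha> \<le> 1" and p0: "p0 \<in> prob_simplex d"
    and mono: "antimono_on {1..d} p0" and j: "j \<in> {1..d}"
  shows "ereal ((1 - \<gamma>) / 30 * min (sqrt (real j) / sqrt (real n * \<alpha>\<^sup>2)) (p0 j / sqrt (ln (2 * real j))))
    \<le> critical_radius TYPE('z) \<gamma> n \<alpha> d p0 1"
proof (rule critical_radius_ge)
  fix \<delta> :: real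
  define N where "N = real n * \<alpha>\<^sup>2"
  define c where "c = (1 - \<gamma>) / 30"
  assume \<delta>: "0 < \<delta>" "\<delta> < (1 - \<gamma>) / 30 * min (sqrt (real j) / sqrt (real n * \<alpha>\<^sup>2)) (p0 j / sqrt (ln (2 * real j)))"
    and H1: "H1 d p0 \<delta> 1 \<noteq> {}"
  have N: "0 < N" using n \<alpha> by (simp add: N_def)
  have c: "0 < c" "c \<le> 1" using \<gamma> by (auto simp: c_def)
  have \<delta>_N: "\<delta> < c * (sqrt j / sqrt N)" and \<delta>_p: "\<delta> < c * (p0 j / sqrt (ln (2 * real j)))"
    using \<delta>(2) c by (auto simp: N_def[symmetric] c_def[symmetric] min_mult_distrib_left)
  have "\<delta> * sqrt N \<le> c * sqrt j" using \<delta>_N N by (simp add: field_simps)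
  then have "(\<delta> * sqrt N)\<^sup>2 \<le> (c * sqrt j)\<^sup>2" using \<delta> N by (intro power_mono) auto
  then have N\<delta>: "N * \<delta>\<^sup>2 \<le> c\<^sup>2 * j" using N by (simp add: power_mult_distrib mult.commute)
  show "ereal \<gamma> < ldp_risk TYPE('z) n \<alpha> d p0 \<delta> 1"
  proof (cases "j = 1")
    case True
    have "c\<^sup>2 \<le> (1 - \<gamma>)\<^sup>2 / 192" by (simp add: c_def power_divide)
    then have "real n * \<alpha>\<^sup>2 * \<delta>\<^sup>2 \<le> (1 - \<gamma>)\<^sup>2 / 192" using N\<delta> True by (simp add: N_def)
    then show ?thesis by (rule ldp_risk_gt_L1[OF \<gamma> \<alpha> p0 \<delta>(1) H1])
  next
    case False
    define m where "m = j div 2"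
    have j2: "2 \<le> j" using j False by auto
    \<comment> \<open>\<open>j \<le> 3 * m\<close> bounds the loss from rounding
      \<open>j div 2\<close> down, the worst case being \<open>j = 3\<close>.\<close>
    have m: "1 \<le> m" "2 * m \<le> j" "j \<le> 3 * m" using j2 by (auto simp: m_def)
    show ?thesis
    proof (rule ldp_risk_gt_pairs[OF \<gamma> \<alpha> p0 \<delta>(1) m(1)])
      show "2 * m \<le> d" using m j by auto
    next
      fix x assume x: "x \<in> {1..2 * m}"
      \<comment> \<open>From \<open>j = 2\<close> on the logarithm is at least 1, so the second
        entry of the minimum is at most \<open>p0 j\<close>.\<close>
      have "exp 1 \<le> 2 * real j" using exp_le j2 by linarith
      then have ln: "1 \<le> ln (2 * real j)" using j2 by (subst ln_ge_iff) auto
      have pj: "0 \<le> p0 j" using prob_simplexD(2)[OF p0 j] .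
      have "\<delta> / (2 * m) \<le> \<delta> / 1" using \<delta>(1) m(1) by (intro divide_left_mono) auto
      also have "\<delta> / 1 \<le> c * (p0 j / sqrt (ln (2 * real j)))" using \<delta>_p by simp
      also have "\<dots> \<le> 1 * (p0 j / 1)"
        using c pj ln by (intro mult_mono divide_left_mono) auto
      also have "\<dots> \<le> p0 x"
        using monotone_onD[OF mono, of x j] x j m(2) by auto
      finally show "\<delta> / (2 * real m) \<le> p0 x" by simp
    next
      have "N * (\<delta>\<^sup>2 / m) \<le> c\<^sup>2 * j / m" using N\<delta> m(1) by (simp add: divide_right_mono)
      also have "\<dots> \<le> c\<^sup>2 * (3 * m) / m" using m(3) by (intro divide_right_mono mult_left_mono) auto
      also have "\<dots> = 3 * c\<^sup>2" using m(1) by simp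
      also have "\<dots> \<le> (1 - \<gamma>)\<^sup>2 / 192" by (simp add: c_def power_divide)
      finally show "real n * \<alpha>\<^sup>2 * (\<delta>\<^sup>2 / real m) \<le> (1 - \<gamma>)\<^sup>2 / 192" by (simp add: N_def)
    qed
  qed
qed

theorem theorem8:
  fixes \<gamma> :: real
  assumes "0 < \<gamma>" and "\<gamma> < 1"
  shows "(\<exists>c1>0. \<exists>c2>0. \<forall>(n::nat) (d::nat) (\<alpha>::real) p0.
            1 \<le> n \<and> 0 < \<alpha> \<and> \<alpha> \<le> 1 \<and> p0 \<in> prob_simplex d \<longrightarrow>
            (antimono_on {1..d} p0 \<longrightarrow>
               critical_radius TYPE('z) \<gamma> n \<alpha> d p0 1 \<ge>
                 ereal (c1 * (MAX j\<in>{1..d}. min (sqrt (real j) / sqrt (real n * \<alpha>\<^sup>2))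
                                                (p0 j / sqrt (ln (2 * real j)))))) \<and>
            critical_radius TYPE('z) \<gamma> n \<alpha> d p0 2 \<ge> ereal (c2 * (1 / sqrt (real n * \<alpha>\<^sup>2)))) \<and>
         (\<exists>c1>0. \<forall>(n::nat) (d::nat) (\<alpha>::real) p0.
            1 \<le> n \<and> 0 < \<alpha> \<and> \<alpha> \<le> 1 \<and> p0 \<in> prob_simplex d \<and> antimono_on {1..d} p0 \<longrightarrow>
            critical_radius TYPE('z) \<gamma> n \<alpha> d p0 1 \<ge>
              ereal (c1 * (sqrt (real (ell_tilde (real n * \<alpha>\<^sup>2) d p0)) / sqrt (real n * \<alpha>\<^sup>2))))"
proof -
  define c where "c = (1 - \<gamma>) / 30"
  have c: "0 < c" using assms by (simp add: c_def)
  have L1: "ereal (c * (MAX j\<in>{1..d}. min (sqrt (real j) / sqrt (real n * \<alpha>\<^sup>2)) (p0 j / sqrt (ln (2 * real j)))))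
      \<le> critical_radius TYPE('z) \<gamma> n \<alpha> d p0 1"
    if "1 \<le> n" "0 < \<alpha>" "\<alpha> \<le> 1" "p0 \<in> prob_simplex d" "antimono_on {1..d} p0" for n d \<alpha> p0
  proof -
    let ?f = "\<lambda>j. min (sqrt (real j) / sqrt (real n * \<alpha>\<^sup>2)) (p0 j / sqrt (ln (2 * real j)))"
    have "Max (?f ` {1..d}) \<in> ?f ` {1..d}"
      using prob_simplexD(3)[OF that(4)] by (intro Max_in) auto
    then obtain j where "j \<in> {1..d}" "Max (?f ` {1..d}) = ?f j" by blast
    then show ?thesis unfolding c_def using critical_radius_L1[OF assms that] by simp
  qed
  have ell: "ereal (c * (sqrt (real (ell_tilde (real n * \<alpha>\<^sup>2) d p0)) / sqrt (real n * \<alpha>\<^sup>2)))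
      \<le> critical_radius TYPE('z) \<gamma> n \<alpha> d p0 1"
    if "1 \<le> n" "0 < \<alpha>" "\<alpha> \<le> 1" "p0 \<in> prob_simplex d" "antimono_on {1..d} p0" for n d \<alpha> p0
  proof -
    let ?l = "ell_tilde (real n * \<alpha>\<^sup>2) d p0"
    let ?J = "{j \<in> {1..d}. sqrt (real j) / sqrt (real n * \<alpha>\<^sup>2) \<le> p0 j / sqrt (ln (2 * real j))}"
    have "?l \<in> insert 0 ?J" unfolding ell_tilde_def by (rule Max_in) auto
    then consider "?l = 0" | "?l \<in> ?J" by (rule insertE)
    then show ?thesis
    proof cases
      case 1
      \<comment> \<open>With the default value 0 of \<open>ell_tilde\<close> the claim is that the
        radius is nonnegative; no \<open>\<delta>\<close> lies strictly between 0 and 0.\<close>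
      show ?thesis by (rule critical_radius_ge) (use 1 in simp)
    next
      case 2
      then have "?l \<in> {1..d}" by blast
      \<comment> \<open>At \<open>ell_tilde\<close> its defining inequality selects the first entry
        of the minimum.\<close>
      moreover have "min (sqrt (real ?l) / sqrt (real n * \<alpha>\<^sup>2)) (p0 ?l / sqrt (ln (2 * real ?l)))
          = sqrt (real ?l) / sqrt (real n * \<alpha>\<^sup>2)" using 2 by (intro min_absorb1) blast
      ultimately show ?thesis unfolding c_def using critical_radius_L1[OF assms that, of ?l] by metis
    qed
  qed
  have L2: "ereal (c * (1 / sqrt (real n * \<alpha>\<^sup>2))) \<le> critical_radius TYPE('z) \<gamma> n \<alpha> d p0 2"
    if "1 \<le> n" "0 < \<alpha>" "\<alpha> \<le> 1" "p0 \<in> prob_simplex d" for n d \<alpha> p0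
    unfolding c_def by (rule critical_radius_L2[OF assms that])
  show ?thesis using c L1 L2 ell by (intro conjI exI[of _ c] allI impI) auto
qed

end
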